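(* Let $(X,\mathfrak A,\mathsf m)$ be a $\sigma$-finite measure space and let $E\colon L^2(\mathsf m)\to[0,\infty]$ be a non-negative even Dirichlet functional with $E(0)=0$, with domain $D(E)=\{u:E(u)<\infty\}$. Then the following are equivalent: $(L_0)$ for every $u\in D(E)$ and every $\alpha\ge0$: $E(|u+\alpha|-\alpha)=E(u)$; $(L_1)$ for every $u,v\in D(E)$ with $(u-c)v=0$ a.e. for some $c\in\mathbb R$ and with $u+v\in D(E)$: $E(u+v)=E(u)+E(v)$; $(L_2)$ for every $u,v\in D(E)$ with $uv=0$ a.e.: $E(u\vee v)+E(u\wedge v)=E(u)+E(v)$; and, for every $u,v\in D(E)$ with $(u-c)v=0$ a.e. for some $c\in\mathbb R$: $$E(h^+_{|c|}(u,v))+E(k^+_{|c|}(u,v))=E(u)+E(v)\quad\text{and}\quad E(h^-_{|c|}(u,v))+E(k^-_{|c|}(u,v))=E(u)+E(v);$$ $(L_3)$ for every $u\in D(E)$ and every $\varphi,\psi\in\Phi$ with $\operatorname{supp}\varphi\cap\operatorname{supp}\psi=\emptyset$: $(\varphi_\circ+\psi_\circ)\circ u\in D(E)$ and $$E((\varphi_\circ+\psi_\circ)\circ u)=E(\varphi_\circ\circ u)+E(\psi_\circ\circ u).$$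
   Context: $L^2(\mathsf m)$ is the real Lebesgue space; $\wedge,\vee$ are pointwise minimum/maximum; compositions of real functions with elements of $L^2$ are pointwise a.e. For $\alpha\ge0$: $h_\alpha^+(s,t)=s\wedge(t+\alpha)$, $k_\alpha^+(s,t)=t\vee(s-\alpha)$, $h_\alpha^-(s,t)=s\vee(t-\alpha)$, $k_\alpha^-(s,t)=t\wedge(s+\alpha)$. $\Phi=\{\varphi\colon\mathbb R\to\mathbb R:\ |\varphi(s)-\varphi(t)|\le|s-t|\ \forall s,t\in\mathbb R\}$, and $\varphi_\circ=\varphi-\varphi(0)$; $\operatorname{supp}$ denotes the support. $E$ is even if $-u\in D(E)$ and $E(-u)\le E(u)$ for every $u\in D(E)$. Set $C_\le=\{(u,v)\in L^2\oplus L^2: u\le v \text{ a.e.}\}$ and, for $\alpha\in[0,\infty]$, $C_\alpha=\{(u,v)\in L^2\oplus L^2: |u-v|\le\alpha\text{ a.e.}\}$; let $P_\le,P_\alpha$ be the metric projections of the Hilbert space $L^2\oplus L^2$ onto them, and $E^{\oplus2}(u,v)=E(u)+E(v)$. $E$ is Markovian if $E^{\oplus2}(P_\le w)\le E^{\oplus2}(w)$ and $E^{\oplus2}(P_\alpha w)\le E^{\oplus2}(w)$ for all $w\in L^2\oplus L^2$, $\alpha\in[0,\infty]$. $E$ is a Dirichlet functional if it is proper ($D(E)\ne\emptyset$), convex, lower semicontinuous and Markovian. *)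

theory Defs
  imports "HOL-Analysis.Analysis"
begin

text \<open>
  Elements of the real space \<open>L\<^sup>2(m)\<close> are represented by square-integrable measurable functions;
  accordingly a functional \<open>E : L\<^sup>2(m) \<rightarrow> [0,\<infinity>]\<close> is a function on such representatives that is
  compatible with almost-everywhere equality. Its values on other functions are irrelevant.
\<close>

definition L2 :: "'a measure \<Rightarrow> ('a \<Rightarrow> real) set" where
  "L2 M = {u \<in> borel_measurable M. integrable M (\<lambda>x. (u x)\<^sup>2)}"

definition L2_norm :: "'a measure \<Rightarrow> ('a \<Rightarrow> real) \<Rightarrow> real" where
  "L2_norm M u = sqrt (LINT x|M. (u x)\<^sup>2)"

definition functional_on_L2 :: "'a measure \<Rightarrow> (('a \<Rightarrow> real) \<Rightarrow> ennreal) \<Rightarrow> bool" where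
  "functional_on_L2 M E \<longleftrightarrow>
     (\<forall>u\<in>L2 M. \<forall>v\<in>L2 M. (AE x in M. u x = v x) \<longrightarrow> E u = E v)"

definition domain_of :: "'a measure \<Rightarrow> (('a \<Rightarrow> real) \<Rightarrow> ennreal) \<Rightarrow> ('a \<Rightarrow> real) set" where
  "domain_of M E = {u \<in> L2 M. E u < \<infinity>}"

definition convex_functional :: "'a measure \<Rightarrow> (('a \<Rightarrow> real) \<Rightarrow> ennreal) \<Rightarrow> bool" where
  "convex_functional M E \<longleftrightarrow>
     (\<forall>u\<in>L2 M. \<forall>v\<in>L2 M. \<forall>t::real. 0 \<le> t \<and> t \<le> 1 \<longrightarrow>
        E (\<lambda>x. (1 - t) * u x + t * v x) \<le> ennreal (1 - t) * E u + ennreal t * E v)"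

definition lsc_functional :: "'a measure \<Rightarrow> (('a \<Rightarrow> real) \<Rightarrow> ennreal) \<Rightarrow> bool" where
  "lsc_functional M E \<longleftrightarrow>
     (\<forall>u\<in>L2 M. \<forall>a<E u. \<exists>\<delta>>0. \<forall>v\<in>L2 M. L2_norm M (\<lambda>x. v x - u x) < \<delta> \<longrightarrow> a < E v)"

definition even_functional :: "'a measure \<Rightarrow> (('a \<Rightarrow> real) \<Rightarrow> ennreal) \<Rightarrow> bool" where
  "even_functional M E \<longleftrightarrow>
     (\<forall>u\<in>domain_of M E. (\<lambda>x. - u x) \<in> domain_of M E \<and> E (\<lambda>x. - u x) \<le> E u)"

definition L2_sum_dist ::
  "'a measure \<Rightarrow> ('a \<Rightarrow> real) \<times> ('a \<Rightarrow> real) \<Rightarrow> ('a \<Rightarrow> real) \<times> ('a \<Rightarrow> real) \<Rightarrow> real" where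
  "L2_sum_dist M w z =
     sqrt ((L2_norm M (\<lambda>x. fst w x - fst z x))\<^sup>2 + (L2_norm M (\<lambda>x. snd w x - snd z x))\<^sup>2)"

text \<open>
  \<open>p\<close> represents the metric projection of \<open>w\<close> onto \<open>C\<close>. This is a relation because the
  projection is determined only up to almost-everywhere equality.
\<close>

definition is_metric_projection ::
  "'a measure \<Rightarrow> (('a \<Rightarrow> real) \<times> ('a \<Rightarrow> real)) set \<Rightarrow>
   ('a \<Rightarrow> real) \<times> ('a \<Rightarrow> real) \<Rightarrow> ('a \<Rightarrow> real) \<times> ('a \<Rightarrow> real) \<Rightarrow> bool" where
  "is_metric_projection M C w p \<longleftrightarrow>
     p \<in> C \<and> (\<forall>q\<in>C. L2_sum_dist M w p \<le> L2_sum_dist M w q)"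

definition C_le :: "'a measure \<Rightarrow> (('a \<Rightarrow> real) \<times> ('a \<Rightarrow> real)) set" where
  "C_le M = {(u, v). u \<in> L2 M \<and> v \<in> L2 M \<and> (AE x in M. u x \<le> v x)}"

definition C_dist :: "'a measure \<Rightarrow> ennreal \<Rightarrow> (('a \<Rightarrow> real) \<times> ('a \<Rightarrow> real)) set" where
  "C_dist M \<alpha> =
     {(u, v). u \<in> L2 M \<and> v \<in> L2 M \<and> (AE x in M. ennreal \<bar>u x - v x\<bar> \<le> \<alpha>)}"

definition sum_functional ::
  "(('a \<Rightarrow> real) \<Rightarrow> ennreal) \<Rightarrow> ('a \<Rightarrow> real) \<times> ('a \<Rightarrow> real) \<Rightarrow> ennreal" where
  "sum_functional E w = E (fst w) + E (snd w)"

definition Markovian :: "'a measure \<Rightarrow> (('a \<Rightarrow> real) \<Rightarrow> ennreal) \<Rightarrow> bool" where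
  "Markovian M E \<longleftrightarrow>
     (\<forall>w \<in> L2 M \<times> L2 M.
        (\<forall>p. is_metric_projection M (C_le M) w p \<longrightarrow> sum_functional E p \<le> sum_functional E w) \<and>
        (\<forall>\<alpha> p. is_metric_projection M (C_dist M \<alpha>) w p \<longrightarrow>
           sum_functional E p \<le> sum_functional E w))"

definition Dirichlet_functional :: "'a measure \<Rightarrow> (('a \<Rightarrow> real) \<Rightarrow> ennreal) \<Rightarrow> bool" where
  "Dirichlet_functional M E \<longleftrightarrow>
     functional_on_L2 M E \<and> domain_of M E \<noteq> {} \<and>
     convex_functional M E \<and> lsc_functional M E \<and> Markovian M E"

definition h_plus :: "real \<Rightarrow> real \<Rightarrow> real \<Rightarrow> real" where
  "h_plus \<alpha> s t = min s (t + \<alpha>)"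

definition k_plus :: "real \<Rightarrow> real \<Rightarrow> real \<Rightarrow> real" where
  "k_plus \<alpha> s t = max t (s - \<alpha>)"

definition h_minus :: "real \<Rightarrow> real \<Rightarrow> real \<Rightarrow> real" where
  "h_minus \<alpha> s t = max s (t - \<alpha>)"

definition k_minus :: "real \<Rightarrow> real \<Rightarrow> real \<Rightarrow> real" where
  "k_minus \<alpha> s t = min t (s + \<alpha>)"

definition contractions :: "(real \<Rightarrow> real) set" where
  "contractions = {\<phi>. \<forall>s t. \<bar>\<phi> s - \<phi> t\<bar> \<le> \<bar>s - t\<bar>}"

definition recentre :: "(real \<Rightarrow> real) \<Rightarrow> real \<Rightarrow> real" where
  "recentre \<phi> s = \<phi> s - \<phi> 0"

definition supp :: "(real \<Rightarrow> real) \<Rightarrow> real set" where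
  "supp \<phi> = closure {s. \<phi> s \<noteq> 0}"

definition locality_L0 :: "'a measure \<Rightarrow> (('a \<Rightarrow> real) \<Rightarrow> ennreal) \<Rightarrow> bool" where
  "locality_L0 M E \<longleftrightarrow>
     (\<forall>u\<in>domain_of M E. \<forall>\<alpha>\<ge>0. E (\<lambda>x. \<bar>u x + \<alpha>\<bar> - \<alpha>) = E u)"

definition locality_L1 :: "'a measure \<Rightarrow> (('a \<Rightarrow> real) \<Rightarrow> ennreal) \<Rightarrow> bool" where
  "locality_L1 M E \<longleftrightarrow>
     (\<forall>u\<in>domain_of M E. \<forall>v\<in>domain_of M E.
        (\<exists>c::real. AE x in M. (u x - c) * v x = 0) \<and> (\<lambda>x. u x + v x) \<in> domain_of M E \<longrightarrow>
        E (\<lambda>x. u x + v x) = E u + E v)"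

definition locality_L2 :: "'a measure \<Rightarrow> (('a \<Rightarrow> real) \<Rightarrow> ennreal) \<Rightarrow> bool" where
  "locality_L2 M E \<longleftrightarrow>
     (\<forall>u\<in>domain_of M E. \<forall>v\<in>domain_of M E.
        (AE x in M. u x * v x = 0) \<longrightarrow>
        E (\<lambda>x. max (u x) (v x)) + E (\<lambda>x. min (u x) (v x)) = E u + E v) \<and>
     (\<forall>u\<in>domain_of M E. \<forall>v\<in>domain_of M E. \<forall>c::real.
        (AE x in M. (u x - c) * v x = 0) \<longrightarrow>
        E (\<lambda>x. h_plus \<bar>c\<bar> (u x) (v x)) + E (\<lambda>x. k_plus \<bar>c\<bar> (u x) (v x)) = E u + E v \<and>
        E (\<lambda>x. h_minus \<bar>c\<bar> (u x) (v x)) + E (\<lambda>x. k_minus \<bar>c\<bar> (u x) (v x)) = E u + E v)"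

definition locality_L3 :: "'a measure \<Rightarrow> (('a \<Rightarrow> real) \<Rightarrow> ennreal) \<Rightarrow> bool" where
  "locality_L3 M E \<longleftrightarrow>
     (\<forall>u\<in>domain_of M E. \<forall>\<phi>\<in>contractions. \<forall>\<psi>\<in>contractions.
        supp \<phi> \<inter> supp \<psi> = {} \<longrightarrow>
        (\<lambda>x. recentre \<phi> (u x) + recentre \<psi> (u x)) \<in> domain_of M E \<and>
        E (\<lambda>x. recentre \<phi> (u x) + recentre \<psi> (u x)) =
          E (\<lambda>x. recentre \<phi> (u x)) + E (\<lambda>x. recentre \<psi> (u x)))"

end

theory Submission
  imports Defs
begin

text \<open>
  Along the segments \<open>u - (1 - s) f\<close>, \<open>v + s f\<close> joining a pair to its reflection in a convex set, the
  inequality for the metric projection onto that set can be summed over a dyadic grid; by lower semicontinuity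
  the midpoint inequality becomes
  \<open>E (u \<and> v) + E (u \<or> v) \<le> E u + E v\<close> and \<open>E (h\<^sup>+ (u, v)) + E (k\<^sup>+ (u, v)) \<le> E u + E v\<close>.
  All four locality properties are compared with \<open>(L\<^sub>0)\<close>. Under \<open>(L\<^sub>0)\<close> the energy is additive over
  layers, \<open>E w = E (w \<and> c) + E ((w - c)\<^sup>+)\<close>, and \<open>E (f + g) = E (f - g) = E f + E g\<close> for disjoint
  nonnegative \<open>f, g\<close>, provided that \<open>f - g \<in> D(E)\<close>. This proviso can fail, although \<open>f, g \<in> D(E)\<close>.
  However, \<open>f \<and> \<epsilon> - (g - \<epsilon>)\<^sup>+ \<in> D(E)\<close> always holds, so that after shifting \<open>g\<close> down by one layer of
  height \<open>\<epsilon>\<close> additivity can be applied layer by layer; then \<open>\<epsilon> \<rightarrow> 0\<close>. The same shift handles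
  \<open>E (u - v)\<close> when \<open>u\<close> equals its maximum \<open>c \<ge> 0\<close> wherever \<open>v \<noteq> 0\<close>, which gives \<open>(L\<^sub>1)\<close>. Property
  \<open>(L\<^sub>3)\<close> needs in addition \<open>E (\<phi> \<circ> u) \<le> E u\<close> for normal contractions, obtained from \<open>(L\<^sub>1)\<close> by
  piecewise linear approximation. Conversely, \<open>|u + \<alpha>| - \<alpha>\<close> and \<open>u\<close> are sum and difference of the
  same two pieces \<open>u \<or> (-\<alpha>)\<close> and \<open>(u + \<alpha>)\<^sup>-\<close>, to which \<open>(L\<^sub>1)\<close>, \<open>(L\<^sub>2)\<close> and (after separating the
  supports) \<open>(L\<^sub>3)\<close> apply.
\<close>

section \<open>Square-integrable functions, contractions and dyadic summation\<close>

lemma L2_measurable [measurable_dest]: "u \<in> L2 M \<Longrightarrow> u \<in> borel_measurable M"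
  by (simp add: L2_def)

text \<open>The bound \<open>(a + b)\<^sup>2 \<le> 2 * a\<^sup>2 + 2 * b\<^sup>2\<close> reduces
  this to integrability of the two squares. Membership in \<open>L2 M\<close> is mostly derived from
  this lemma below; no finiteness of \<open>M\<close> enters, so constants may occur only in
  dominated combinations.\<close>

lemma L2_dominated:
  assumes u: "u \<in> L2 M" and v: "v \<in> L2 M" and f: "f \<in> borel_measurable M"
    and le: "\<And>x. \<bar>f x\<bar> \<le> \<bar>u x\<bar> + \<bar>v x\<bar>"
  shows "f \<in> L2 M"
proof -
  have "integrable M (\<lambda>x. 2 * (u x)\<^sup>2 + 2 * (v x)\<^sup>2)"
    using u v by (simp add: L2_def)
  moreover have "(\<lambda>x. (f x)\<^sup>2) \<in> borel_measurable M"
    using f by measurable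
  moreover have "norm ((f x)\<^sup>2) \<le> norm (2 * (u x)\<^sup>2 + 2 * (v x)\<^sup>2)" for x
  proof -
    have "(f x)\<^sup>2 \<le> (\<bar>u x\<bar> + \<bar>v x\<bar>)\<^sup>2"
      using power_mono[OF le, of x 2] by simp
    also have "\<dots> \<le> 2 * (u x)\<^sup>2 + 2 * (v x)\<^sup>2"
      using zero_le_power2[of "\<bar>u x\<bar> - \<bar>v x\<bar>"] by (simp add: power2_eq_square algebra_simps)
    finally show ?thesis by simp
  qed
  ultimately have "integrable M (\<lambda>x. (f x)\<^sup>2)"
    using Bochner_Integration.integrable_bound by blast
  then show ?thesis using f by (simp add: L2_def)
qed

lemma L2_dominated1:
  assumes "u \<in> L2 M" "f \<in> borel_measurable M" "\<And>x. \<bar>f x\<bar> \<le> \<bar>u x\<bar>"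
  shows "f \<in> L2 M"
  by (rule L2_dominated[OF assms(1,1,2)]) (rule order_trans[OF assms(3)], simp)

lemma L2_scale: "u \<in> L2 M \<Longrightarrow> (\<lambda>x. c * u x) \<in> L2 M"
  by (auto simp: L2_def power_mult_distrib)

lemma L2_zero: "(\<lambda>x. 0) \<in> L2 M"
  by (simp add: L2_def)

lemma L2_uminus: "u \<in> L2 M \<Longrightarrow> (\<lambda>x. - u x) \<in> L2 M"
  by (simp add: L2_def)

lemma L2_add: "u \<in> L2 M \<Longrightarrow> v \<in> L2 M \<Longrightarrow> (\<lambda>x. u x + v x) \<in> L2 M"
  by (rule L2_dominated[of u _ v]) auto

lemma L2_diff: "u \<in> L2 M \<Longrightarrow> v \<in> L2 M \<Longrightarrow> (\<lambda>x. u x - v x) \<in> L2 M"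
  by (rule L2_dominated[of u _ v]) auto

lemma L2_max: "u \<in> L2 M \<Longrightarrow> v \<in> L2 M \<Longrightarrow> (\<lambda>x. max (u x) (v x)) \<in> L2 M"
  by (rule L2_dominated[of u _ v]) auto

lemma L2_min: "u \<in> L2 M \<Longrightarrow> v \<in> L2 M \<Longrightarrow> (\<lambda>x. min (u x) (v x)) \<in> L2 M"
  by (rule L2_dominated[of u _ v]) auto

lemma L2_contraction:
  assumes u: "u \<in> L2 M" and phi: "\<phi> \<in> contractions" "\<phi> 0 = 0"
  shows "(\<lambda>x. \<phi> (u x)) \<in> L2 M"
proof (rule L2_dominated1[OF u])
  have "continuous_on UNIV \<phi>"
  proof (rule continuous_onI)
    fix x \<epsilon> :: real assume "0 < \<epsilon>"
    moreover have "dist (\<phi> y) (\<phi> x) \<le> dist y x" for y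
      using phi(1) by (simp add: contractions_def dist_real_def)
    ultimately show "\<exists>\<delta>>0. \<forall>y\<in>UNIV. dist y x < \<delta> \<longrightarrow> dist (\<phi> y) (\<phi> x) \<le> \<epsilon>"
      by (metis less_le order_trans)
  qed
  then have [measurable]: "\<phi> \<in> borel_measurable borel"
    by (rule borel_measurable_continuous_onI)
  show "(\<lambda>x. \<phi> (u x)) \<in> borel_measurable M"
    using u by measurable
  show "\<bar>\<phi> (u x)\<bar> \<le> \<bar>u x\<bar>" for x
    using phi unfolding contractions_def by (metis (mono_tags, lifting) diff_zero mem_Collect_eq)
qed

lemma L2_cut: "u \<in> L2 M \<Longrightarrow> 0 \<le> c \<Longrightarrow> (\<lambda>x. min (u x) c) \<in> L2 M"
  by (rule L2_dominated1[of u]) auto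

lemma L2_excess: "u \<in> L2 M \<Longrightarrow> 0 \<le> c \<Longrightarrow> (\<lambda>x. max (u x - c) 0) \<in> L2 M"
  by (rule L2_dominated1[of u]) auto

lemmas L2_intros = L2_zero L2_uminus L2_add L2_diff L2_scale L2_max L2_min L2_cut L2_excess

text \<open>Dominated convergence for the squares. It turns the pointwise limits used later into
  limits in norm, which lower semicontinuity requires.\<close>

lemma L2_norm_tendsto_0:
  assumes g: "g \<in> L2 M" and f: "\<And>n. f n \<in> L2 M"
    and le: "\<And>n x. \<bar>f n x\<bar> \<le> \<bar>g x\<bar>" and lim: "\<And>x. (\<lambda>n. f n x) \<longlonglongrightarrow> 0"
  shows "(\<lambda>n. L2_norm M (f n)) \<longlonglongrightarrow> 0"
proof -
  have "(\<lambda>n. LINT x|M. (f n x)\<^sup>2) \<longlonglongrightarrow> (LINT x|M. 0)"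
  proof (rule integral_dominated_convergence[where w="\<lambda>x. (g x)\<^sup>2"])
    show "integrable M (\<lambda>x. (g x)\<^sup>2)" using g by (simp add: L2_def)
    show "(\<lambda>x. (f n x)\<^sup>2) \<in> borel_measurable M" for n
      using f[of n] by measurable
    show "AE x in M. (\<lambda>n. (f n x)\<^sup>2) \<longlonglongrightarrow> 0"
      using tendsto_power[OF lim, of _ 2] by (intro AE_I2) simp
    show "AE x in M. norm ((f n x)\<^sup>2) \<le> (g x)\<^sup>2" for n
      using le by (intro AE_I2) (simp add: abs_le_square_iff)
  qed simp
  then show ?thesis
    unfolding L2_norm_def using tendsto_real_sqrt by fastforce
qed

section \<open>Metric projections onto pointwise constraints\<close>

lemma is_metric_projectionI:
  assumes w: "u \<in> L2 M" "v \<in> L2 M" and C: "C \<subseteq> L2 M \<times> L2 M" and p: "(p, p') \<in> C"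
    and le: "\<And>q q'. (q, q') \<in> C \<Longrightarrow>
      AE x in M. (u x - p x)\<^sup>2 + (v x - p' x)\<^sup>2 \<le> (u x - q x)\<^sup>2 + (v x - q' x)\<^sup>2"
  shows "is_metric_projection M C (u, v) (p, p')"
proof -
  have int: "integrable M (\<lambda>x. (f x - g x)\<^sup>2)" if "f \<in> L2 M" "g \<in> L2 M" for f g
    using L2_diff[OF that] by (simp add: L2_def)
  have dist: "L2_sum_dist M (u, v) (q, q') = sqrt (LINT x|M. (u x - q x)\<^sup>2 + (v x - q' x)\<^sup>2)"
    if "q \<in> L2 M" "q' \<in> L2 M" for q q'
    using int[OF w(1) that(1)] int[OF w(2) that(2)] by (simp add: L2_sum_dist_def L2_norm_def)
  have "L2_sum_dist M (u, v) (p, p') \<le> L2_sum_dist M (u, v) (q, q')" if q: "(q, q') \<in> C" for q q'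
  proof -
    have L2: "p \<in> L2 M" "p' \<in> L2 M" "q \<in> L2 M" "q' \<in> L2 M"
      using C p q by auto
    \<comment> \<open>Minimising the squared distance in the plane at almost every \<open>x\<close>
      minimises its integral, so the projection may be computed fibrewise.\<close>
    have "(LINT x|M. (u x - p x)\<^sup>2 + (v x - p' x)\<^sup>2) \<le> (LINT x|M. (u x - q x)\<^sup>2 + (v x - q' x)\<^sup>2)"
      using w L2 le[OF q] by (intro integral_mono_AE Bochner_Integration.integrable_add int)
    then show ?thesis using L2 by (simp add: dist)
  qed
  then show ?thesis using p by (auto simp: is_metric_projection_def)
qed

text \<open>The point \<open>((a + b + c) / 2, (a + b - c) / 2)\<close> is the orthogonal projection
  of \<open>(a, b)\<close> onto the half-plane of all \<open>(q, q')\<close> with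
  \<open>q - q' \<le> c\<close>; the squared distance is \<open>d\<^sup>2 / 2\<close> for the excess
  \<open>d = a - b - c\<close>.\<close>

lemma sq_dist_halfplane:
  fixes a b q q' c :: real
  assumes "q - q' \<le> c" "c \<le> a - b"
  shows "(a - (a + b + c) / 2)\<^sup>2 + (b - (a + b - c) / 2)\<^sup>2 \<le> (a - q)\<^sup>2 + (b - q')\<^sup>2"
proof -
  define d where "d = a - b - c"
  have d: "0 \<le> d" using assms by (simp add: d_def)
  have "d \<le> (a - q) - (b - q')" using assms by (simp add: d_def)
  then have "d\<^sup>2 \<le> ((a - q) - (b - q'))\<^sup>2" using d by (rule power_mono)
  also have "\<dots> \<le> 2 * ((a - q)\<^sup>2 + (b - q')\<^sup>2)"
    using zero_le_power2[of "(a - q) + (b - q')"] by (simp add: power2_eq_square algebra_simps)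
  finally have "d\<^sup>2 / 2 \<le> (a - q)\<^sup>2 + (b - q')\<^sup>2" by simp
  moreover have eq: "(a - (a + b + c) / 2) = d / 2" "(b - (a + b - c) / 2) = - (d / 2)"
    by (simp_all add: d_def field_simps)
  ultimately show ?thesis unfolding eq by (simp add: power_divide)
qed

section \<open>Extended-real estimates and dyadic summation\<close>

lemma Liminf_add_le_ennreal:
  fixes a b :: "nat \<Rightarrow> ennreal"
  assumes "\<And>n. a n + b n \<le> C"
  shows "liminf a + liminf b \<le> C"
proof -
  \<comment> \<open>Tail infima increase, so the supremum of their sum is the sum of their suprema:
    this is superadditivity of the lower limit.\<close>
  have inc: "incseq (\<lambda>n. INF m\<in>{n..}. f m)" for f :: "nat \<Rightarrow> ennreal"
    by (auto simp: incseq_def intro!: INF_superset_mono)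
  have "liminf a + liminf b = (SUP n. (INF m\<in>{n..}. a m) + (INF m\<in>{n..}. b m))"
    by (simp add: liminf_SUP_INF ennreal_SUP_add[OF inc inc])
  also have "\<dots> \<le> C"
  proof (rule SUP_least)
    fix n
    have "(INF m\<in>{n..}. a m) + (INF m\<in>{n..}. b m) \<le> a n + b n"
      by (intro add_mono INF_lower) auto
    then show "(INF m\<in>{n..}. a m) + (INF m\<in>{n..}. b m) \<le> C"
      using assms order_trans by blast
  qed
  finally show ?thesis .
qed

lemma ennreal_add_right_le_cancel:
  fixes a b c :: ennreal
  assumes "a + c \<le> b + c" "c \<noteq> \<infinity>"
  shows "a \<le> b"
  using assms by (simp add: add.commute[of _ c] ennreal_add_left_cancel_le)

lemma ennreal_add_leD:
  fixes a b c :: ennreal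
  assumes "a + b \<le> c"
  shows "a \<le> c" "b \<le> c"
  by (rule order_trans[OF _ assms], simp)+

text \<open>Self-similar form of a summation over a dyadic grid; the intermediate values
  \<open>p m + q m\<close> are finite and cancel.\<close>
lemma dyadic_exchange:
  fixes p q :: "real \<Rightarrow> ennreal"
  assumes mid: "\<And>s t. 0 \<le> t \<Longrightarrow> t \<le> s \<Longrightarrow> s \<le> 1 \<Longrightarrow> p ((s + t) / 2) + q ((s + t) / 2) \<le> p s + q t"
    and st: "0 \<le> t" "t \<le> s" "s \<le> 1"
  shows "p (t + (s - t) / 2 ^ k) + q (s - (s - t) / 2 ^ k) \<le> p s + q t"
  using st
proof (induction k arbitrary: s t)
  case 0
  then show ?case by simp
next
  case (Suc k)
  define m h where "m = (s + t) / 2" and "h = (s - t) / 2 ^ Suc k"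
  have h: "(m - t) / 2 ^ k = h" "(s - m) / 2 ^ k = h"
    by (simp_all add: m_def h_def field_simps)
  have m: "t \<le> m" "m \<le> s" using Suc.prems by (simp_all add: m_def)
  have "h \<le> (s - t) / 2"
    unfolding h_def using Suc.prems by (intro divide_left_mono) auto
  then have "m + h \<le> s" "t \<le> m - h" by (simp_all add: m_def field_simps)
  moreover have "0 \<le> h" using Suc.prems by (simp add: h_def)
  \<comment> \<open>The points \<open>m + h\<close> and \<open>m - h\<close> have midpoint
    \<open>m\<close>, so \<open>mid\<close> bounds the values at \<open>m\<close> by exactly the
    terms that the two half intervals leave over.\<close>
  ultimately have mh: "p m + q m \<le> p (m + h) + q (m - h)"
    using mid[of "m - h" "m + h"] Suc.prems by simp
  have pm: "p m + q m \<le> p s + q t"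
    using mid[of t s] Suc.prems by (simp add: m_def)
  have "p (t + h) + q (s - h) \<le> p s + q t"
  proof (cases "p s + q t = \<infinity>")
    case False
    have IH: "p (t + h) + q (m - h) \<le> p m + q t" "p (m + h) + q (s - h) \<le> p s + q m"
      using Suc.IH[of t m] Suc.IH[of m s] m Suc.prems unfolding h by linarith+
    \<comment> \<open>The estimates on \<open>[t, m]\<close> and \<open>[m, s]\<close> share the
      step \<open>h\<close>; \<open>mh\<close> exchanges their inner terms for
      \<open>p m + q m\<close>.\<close>
    have "p (t + h) + q (s - h) + (p m + q m) \<le> (p (t + h) + q (s - h)) + (p (m + h) + q (m - h))"
      using mh by (rule add_left_mono)
    also have "\<dots> = (p (t + h) + q (m - h)) + (p (m + h) + q (s - h))"
      by (simp add: ac_simps)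
    also have "\<dots> \<le> (p m + q t) + (p s + q m)"
      using IH by (rule add_mono)
    also have "\<dots> = (p s + q t) + (p m + q m)"
      by (simp add: ac_simps)
    finally show ?thesis
    proof (rule ennreal_add_right_le_cancel)
      show "p m + q m \<noteq> \<infinity>" using pm False by (auto simp: top_unique)
    qed
  next
    case True
    then show ?thesis by (simp only: infinity_ennreal_def top_greatest)
  qed
  then show ?case by (simp only: h_def)
qed

section \<open>Contractions of the line with disjoint supports\<close>

lemma contractionsD: "\<phi> \<in> contractions \<Longrightarrow> \<bar>\<phi> s - \<phi> t\<bar> \<le> \<bar>s - t\<bar>"
  by (simp add: contractions_def)

lemma recentre_contractions: "\<phi> \<in> contractions \<Longrightarrow> recentre \<phi> \<in> contractions"
  by (simp add: contractions_def recentre_def)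

lemma recentre_0 [simp]: "recentre \<phi> 0 = 0"
  by (simp add: recentre_def)

lemma in_suppI: "\<phi> s \<noteq> 0 \<Longrightarrow> s \<in> supp \<phi>"
  unfolding supp_def by (rule subsetD[OF closure_subset]) simp

lemma supp_disjointD: "supp \<phi> \<inter> supp \<psi> = {} \<Longrightarrow> \<phi> s = 0 \<or> \<psi> s = 0"
  using in_suppI[of \<phi> s] in_suppI[of \<psi> s] by blast

text \<open>If \<open>\<phi> s\<close> and \<open>\<psi> t\<close> are both nonzero, then, the segment being connected, some point
  between \<open>s\<close> and \<open>t\<close> lies outside both supports.\<close>
lemma contraction_cross:
  assumes "\<phi> \<in> contractions" "\<psi> \<in> contractions" "supp \<phi> \<inter> supp \<psi> = {}"
    and "\<phi> s \<noteq> 0" "\<psi> t \<noteq> 0"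
  shows "\<bar>\<phi> s - \<psi> t\<bar> \<le> \<bar>s - t\<bar>"
proof -
  have "s \<in> supp \<phi>" "t \<in> supp \<psi>"
    using assms(4,5) by (auto intro: in_suppI)
  then have "supp \<phi> \<inter> closed_segment s t \<noteq> {}" "supp \<psi> \<inter> closed_segment s t \<noteq> {}" by auto
  then have "\<not> closed_segment s t \<subseteq> supp \<phi> \<union> supp \<psi>"
    using connected_closedD[OF connected_segment(1), of "supp \<phi>" "supp \<psi>" s t] assms(3)
    by (auto simp: supp_def)
  then obtain r where r: "r \<in> closed_segment s t" "r \<notin> supp \<phi>" "r \<notin> supp \<psi>" by blast
  then have "\<phi> r = 0" "\<psi> r = 0"
    using in_suppI by blast+
  moreover have "\<bar>s - r\<bar> + \<bar>r - t\<bar> = \<bar>s - t\<bar>"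
    using r(1) by (auto simp: closed_segment_eq_real_ivl split: if_splits)
  ultimately show ?thesis
    using contractionsD[OF assms(1), of s r] contractionsD[OF assms(2), of r t] by simp
qed

text \<open>At each of \<open>s\<close> and \<open>t\<close> at most one summand is nonzero. If the
  same one survives at both points, its own contraction bound suffices; otherwise
  \<open>contraction_cross\<close> applies.\<close>

lemma contractions_add_disjoint_supp:
  assumes \<phi>: "\<phi> \<in> contractions" and \<psi>: "\<psi> \<in> contractions" and disj: "supp \<phi> \<inter> supp \<psi> = {}"
  shows "(\<lambda>s. recentre \<phi> s + recentre \<psi> s) \<in> contractions"
proof -
  have "\<bar>(\<phi> s + \<psi> s) - (\<phi> t + \<psi> t)\<bar> \<le> \<bar>s - t\<bar>" for s t
  proof -
    have "\<phi> s = 0 \<or> \<psi> s = 0" "\<phi> t = 0 \<or> \<psi> t = 0"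
      using supp_disjointD[OF disj] by auto
    then consider "\<psi> s = 0" "\<psi> t = 0" | "\<phi> s = 0" "\<phi> t = 0"
      | "\<phi> s \<noteq> 0" "\<psi> t \<noteq> 0" "\<psi> s = 0" "\<phi> t = 0" | "\<psi> s \<noteq> 0" "\<phi> t \<noteq> 0" "\<phi> s = 0" "\<psi> t = 0"
      by auto
    then show ?thesis
    proof cases
      case 1
      then show ?thesis using contractionsD[OF \<phi>, of s t] by simp
    next
      case 2
      then show ?thesis using contractionsD[OF \<psi>, of s t] by simp
    next
      case 3
      then show ?thesis using contraction_cross[OF \<phi> \<psi> disj, of s t] by simp
    next
      case 4
      then show ?thesis using contraction_cross[OF \<phi> \<psi> disj, of t s] by simp
    qed
  qed
  then show ?thesis by (simp add: contractions_def recentre_def algebra_simps)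
qed

section \<open>Inequalities for even Dirichlet functionals\<close>

locale even_Dirichlet =
  fixes M :: "'a measure" and E :: "('a \<Rightarrow> real) \<Rightarrow> ennreal"
  assumes dirichlet: "Dirichlet_functional M E"
    and even: "even_functional M E"
    and zero: "E (\<lambda>x. 0) = 0"
begin

section \<open>Symmetry, lower limits and the reflection principle\<close>

abbreviation "D \<equiv> domain_of M E"

lemma D_iff: "u \<in> D \<longleftrightarrow> u \<in> L2 M \<and> E u < \<infinity>"
  by (simp add: domain_of_def)

lemma D_L2: "u \<in> D \<Longrightarrow> u \<in> L2 M"
  by (simp add: domain_of_def)

lemma D_neq_top: "u \<in> D \<Longrightarrow> E u \<noteq> \<infinity>"
  by (auto simp: domain_of_def)

lemma zero_D: "(\<lambda>x. 0) \<in> D"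
  by (simp add: D_iff zero L2_zero)

lemma E_cong_AE: "u \<in> L2 M \<Longrightarrow> v \<in> L2 M \<Longrightarrow> AE x in M. u x = v x \<Longrightarrow> E u = E v"
  using dirichlet unfolding Dirichlet_functional_def functional_on_L2_def by blast

lemma E_convex:
  "u \<in> L2 M \<Longrightarrow> v \<in> L2 M \<Longrightarrow> 0 \<le> t \<Longrightarrow> t \<le> 1 \<Longrightarrow>
    E (\<lambda>x. (1 - t) * u x + t * v x) \<le> ennreal (1 - t) * E u + ennreal t * E v"
  using dirichlet unfolding Dirichlet_functional_def convex_functional_def by blast

lemma uminus_D: "u \<in> D \<Longrightarrow> (\<lambda>x. - u x) \<in> D"
  using even by (simp add: even_functional_def)

text \<open>Evenness supplies only one inequality; using it for both \<open>u\<close> and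
  \<open>- u\<close> gives equality, with infinite values included.\<close>

lemma E_uminus: "u \<in> L2 M \<Longrightarrow> E (\<lambda>x. - u x) = E u"
proof -
  assume u: "u \<in> L2 M"
  have le: "E (\<lambda>x. - w x) \<le> E w" if "w \<in> L2 M" for w
  proof (cases "w \<in> D")
    case True
    then show ?thesis using even by (simp add: even_functional_def)
  next
    case False
    then show ?thesis using that by (auto simp: D_iff less_top[symmetric])
  qed
  from le[OF u] le[OF L2_uminus[OF u]] show ?thesis by simp
qed

lemma E_liminf:
  assumes g: "g \<in> L2 M" and u: "\<And>n. u n \<in> L2 M" "w \<in> L2 M"
    and le: "\<And>n x. \<bar>u n x - w x\<bar> \<le> \<bar>g x\<bar>" and lim: "\<And>x. (\<lambda>n. u n x) \<longlonglongrightarrow> w x"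
  shows "E w \<le> liminf (\<lambda>n. E (u n))"
  unfolding le_Liminf_iff
proof (intro allI impI)
  fix a assume "a < E w"
  then obtain \<delta> where \<delta>: "\<delta> > 0" "\<And>v. v \<in> L2 M \<Longrightarrow> L2_norm M (\<lambda>x. v x - w x) < \<delta> \<Longrightarrow> a < E v"
    using dirichlet u(2) unfolding Dirichlet_functional_def lsc_functional_def by metis
  have "(\<lambda>n. L2_norm M (\<lambda>x. u n x - w x)) \<longlonglongrightarrow> 0"
    using u by (intro L2_norm_tendsto_0[OF g] L2_diff le LIM_zero lim)
  then have "\<forall>\<^sub>F n in sequentially. L2_norm M (\<lambda>x. u n x - w x) < \<delta>"
    using \<delta>(1) by (rule order_tendstoD)
  then show "\<forall>\<^sub>F n in sequentially. a < E (u n)"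
    by eventually_elim (use \<delta>(2) u in auto)
qed

text \<open>Only the sum of the two energies is bounded along the sequences, so lower semicontinuity
  is combined with superadditivity of the lower limit.\<close>

lemma E_add_limit:
  assumes "g \<in> L2 M" "\<And>n. u n \<in> L2 M" "w \<in> L2 M"
    and "\<And>n x. \<bar>u n x - w x\<bar> \<le> \<bar>g x\<bar>" "\<And>x. (\<lambda>n. u n x) \<longlonglongrightarrow> w x"
    and "h \<in> L2 M" "\<And>n. v n \<in> L2 M" "z \<in> L2 M"
    and "\<And>n x. \<bar>v n x - z x\<bar> \<le> \<bar>h x\<bar>" "\<And>x. (\<lambda>n. v n x) \<longlonglongrightarrow> z x"
    and C: "\<And>n. E (u n) + E (v n) \<le> C"
  shows "E w + E z \<le> C"
proof -
  have "E w + E z \<le> liminf (\<lambda>n. E (u n)) + liminf (\<lambda>n. E (v n))"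
    using assms by (intro add_mono E_liminf)
  also have "\<dots> \<le> C" using C by (rule Liminf_add_le_ennreal)
  finally show ?thesis .
qed

lemma E_limit:
  assumes "g \<in> L2 M" "\<And>n. u n \<in> L2 M" "w \<in> L2 M"
    and "\<And>n x. \<bar>u n x - w x\<bar> \<le> \<bar>g x\<bar>" "\<And>x. (\<lambda>n. u n x) \<longlonglongrightarrow> w x"
    and "\<And>n. E (u n) \<le> C"
  shows "E w \<le> C"
  using E_add_limit[OF assms(1-5) L2_zero L2_zero L2_zero, of C] assms(6) by (simp add: zero)

text \<open>Here \<open>dyadic_exchange\<close> runs from parameter 0 to 1. After \<open>k\<close>
  halvings the pair lies within \<open>h k * f\<close> of \<open>(u - f, v + f)\<close>, and
  \<open>k\<close> tends to infinity.\<close>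

lemma E_reflection:
  assumes L2: "u \<in> L2 M" "v \<in> L2 M" "f \<in> L2 M"
    and mid: "\<And>s t. 0 \<le> t \<Longrightarrow> t \<le> s \<Longrightarrow> s \<le> 1 \<Longrightarrow>
      E (\<lambda>x. u x - (1 - (s + t) / 2) * f x) + E (\<lambda>x. v x + (s + t) / 2 * f x)
        \<le> E (\<lambda>x. u x - (1 - s) * f x) + E (\<lambda>x. v x + t * f x)"
  shows "E (\<lambda>x. u x - f x) + E (\<lambda>x. v x + f x) \<le> E u + E v"
proof -
  define h :: "nat \<Rightarrow> real" where "h k = (1 / 2) ^ k" for k
  have h0: "h \<longlonglongrightarrow> 0" unfolding h_def by (intro LIMSEQ_realpow_zero) auto
  have h: "0 \<le> h k" "h k \<le> 1" for k by (simp_all add: h_def power_le_one)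
  have hf: "\<bar>h k * f x\<bar> \<le> \<bar>f x\<bar>" for k x
    using h[of k] by (simp add: abs_mult mult_left_le_one_le)
  have le: "E (\<lambda>x. u x - (1 - h k) * f x) + E (\<lambda>x. v x + (1 - h k) * f x) \<le> E u + E v" for k
    using dyadic_exchange[of "\<lambda>s. E (\<lambda>x. u x - (1 - s) * f x)" "\<lambda>s. E (\<lambda>x. v x + s * f x)" 0 1 k] mid
    by (simp add: h_def power_one_over)
  show ?thesis
  proof (rule E_add_limit[OF L2(3) _ _ _ _ L2(3) _ _ _ _ le])
    show "(\<lambda>k. u x - (1 - h k) * f x) \<longlonglongrightarrow> u x - f x" for x
      by (rule tendsto_eq_intros h0 refl | simp)+
    show "(\<lambda>k. v x + (1 - h k) * f x) \<longlonglongrightarrow> v x + f x" for x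
      by (rule tendsto_eq_intros h0 refl | simp)+
    show "\<bar>u x - (1 - h k) * f x - (u x - f x)\<bar> \<le> \<bar>f x\<bar>" for k x
      using hf[of k x] by (simp add: algebra_simps)
    show "\<bar>v x + (1 - h k) * f x - (v x + f x)\<bar> \<le> \<bar>f x\<bar>" for k x
      using hf[of k x] by (simp add: algebra_simps)
  qed (use L2 in \<open>auto intro!: L2_intros\<close>)
qed

section \<open>The two inequalities drawn from the Markov property\<close>

lemma Markov_le:
  assumes "u \<in> L2 M" "v \<in> L2 M" "is_metric_projection M (C_le M) (u, v) (p, p')"
  shows "E p + E p' \<le> E u + E v"
  using dirichlet assms unfolding Dirichlet_functional_def Markovian_def sum_functional_def
  by (metis fst_conv mem_Sigma_iff snd_conv)

lemma Markov_dist: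
  assumes "u \<in> L2 M" "v \<in> L2 M" "is_metric_projection M (C_dist M \<alpha>) (u, v) (p, p')"
  shows "E p + E p' \<le> E u + E v"
  using dirichlet assms unfolding Dirichlet_functional_def Markovian_def sum_functional_def
  by (metis fst_conv mem_Sigma_iff snd_conv)

text \<open>The pair \<open>(min, max)\<close> is the mirror image of \<open>(u, v)\<close> in the
  boundary of \<open>C_le M\<close> wherever \<open>v < u\<close>, so \<open>E_reflection\<close>
  applies with \<open>f\<close> the positive part of \<open>u - v\<close>.\<close>

lemma E_min_max:
  assumes u: "u \<in> L2 M" and v: "v \<in> L2 M"
  shows "E (\<lambda>x. min (u x) (v x)) + E (\<lambda>x. max (u x) (v x)) \<le> E u + E v"
proof -
  define f where "f = (\<lambda>x. max (u x - v x) 0)"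
  have f: "f \<in> L2 M" unfolding f_def by (intro L2_intros u v)
  have "E (\<lambda>x. u x - f x) + E (\<lambda>x. v x + f x) \<le> E u + E v"
  proof (rule E_reflection[OF u v f])
    fix s t :: real assume st: "0 \<le> t" "t \<le> s" "s \<le> 1"
    let ?U = "\<lambda>x. u x - (1 - s) * f x" and ?V = "\<lambda>x. v x + t * f x"
    let ?P = "\<lambda>x. u x - (1 - (s + t) / 2) * f x" and ?Q = "\<lambda>x. v x + (s + t) / 2 * f x"
    have L2: "?U \<in> L2 M" "?V \<in> L2 M" "?P \<in> L2 M" "?Q \<in> L2 M"
      by (intro L2_intros u v f)+
    \<comment> \<open>Where \<open>f\<close> is nonzero,
      \<open>?U - ?V = (s - t) * f \<ge> 0\<close>, so the point is projected onto the diagonal;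
      elsewhere nothing moves.\<close>
    have cases: "(?U x \<le> ?V x \<and> ?P x = ?U x \<and> ?Q x = ?V x) \<or>
        (0 \<le> ?U x - ?V x \<and> ?P x = (?U x + ?V x + 0) / 2 \<and> ?Q x = (?U x + ?V x - 0) / 2)" for x
    proof (cases "u x \<le> v x")
      case True
      then show ?thesis by (simp add: f_def)
    next
      case False
      then have fx: "u x = v x + f x" "0 \<le> f x" by (simp_all add: f_def)
      have "0 \<le> (s - t) * f x" using st fx by simp
      then show ?thesis unfolding fx(1) by (simp add: field_simps)
    qed
    have "is_metric_projection M (C_le M) (?U, ?V) (?P, ?Q)"
    proof (rule is_metric_projectionI)
      show "C_le M \<subseteq> L2 M \<times> L2 M" by (auto simp: C_le_def)
      have "?P x \<le> ?Q x" for x using cases[of x] by auto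
      then show "(?P, ?Q) \<in> C_le M" using L2 by (simp add: C_le_def)
      fix q q' assume "(q, q') \<in> C_le M"
      then have "AE x in M. q x - q' x \<le> 0" by (auto simp: C_le_def)
      then show "AE x in M. (?U x - ?P x)\<^sup>2 + (?V x - ?Q x)\<^sup>2 \<le> (?U x - q x)\<^sup>2 + (?V x - q' x)\<^sup>2"
      proof eventually_elim
        case (elim x)
        from cases[of x] show ?case
        proof
          assume "?U x \<le> ?V x \<and> ?P x = ?U x \<and> ?Q x = ?V x"
          then show ?thesis by (metis add_nonneg_nonneg diff_self power_zero_numeral add_0 zero_le_power2)
        next
          assume "0 \<le> ?U x - ?V x \<and> ?P x = (?U x + ?V x + 0) / 2 \<and> ?Q x = (?U x + ?V x - 0) / 2"
          then show ?thesis using sq_dist_halfplane[OF elim, of "?U x" "?V x"] by metis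
        qed
      qed
    qed (fact L2)+
    then show "E ?P + E ?Q \<le> E ?U + E ?V" by (rule Markov_le[OF L2(1,2)])
  qed
  also have "(\<lambda>x. u x - f x) = (\<lambda>x. min (u x) (v x))" by (auto simp: f_def)
  also have "(\<lambda>x. v x + f x) = (\<lambda>x. max (u x) (v x))" by (auto simp: f_def)
  finally show ?thesis .
qed

text \<open>The same reflection, now in the face \<open>u - v = \<alpha>\<close> of the strip
  \<open>C_dist M \<alpha>\<close>. The order \<open>v \<le> u\<close> keeps the opposite face out
  of play.\<close>

lemma E_shift_ordered:
  assumes u: "u \<in> L2 M" and v: "v \<in> L2 M" and le: "\<And>x. v x \<le> u x" and "0 \<le> \<alpha>"
  shows "E (\<lambda>x. min (u x) (v x + \<alpha>)) + E (\<lambda>x. max (v x) (u x - \<alpha>)) \<le> E u + E v"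
proof -
  define f where "f = (\<lambda>x. max (u x - v x - \<alpha>) 0)"
  have f: "f \<in> L2 M" unfolding f_def by (intro L2_intros u v \<open>0 \<le> \<alpha>\<close>)
  have "E (\<lambda>x. u x - f x) + E (\<lambda>x. v x + f x) \<le> E u + E v"
  proof (rule E_reflection[OF u v f])
    fix s t :: real assume st: "0 \<le> t" "t \<le> s" "s \<le> 1"
    let ?U = "\<lambda>x. u x - (1 - s) * f x" and ?V = "\<lambda>x. v x + t * f x"
    let ?P = "\<lambda>x. u x - (1 - (s + t) / 2) * f x" and ?Q = "\<lambda>x. v x + (s + t) / 2 * f x"
    have L2: "?U \<in> L2 M" "?V \<in> L2 M" "?P \<in> L2 M" "?Q \<in> L2 M"
      by (intro L2_intros u v f)+
    have cases: "(\<bar>?U x - ?V x\<bar> \<le> \<alpha> \<and> ?P x = ?U x \<and> ?Q x = ?V x) \<or>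
        (\<alpha> \<le> ?U x - ?V x \<and> ?P x = (?U x + ?V x + \<alpha>) / 2 \<and> ?Q x = (?U x + ?V x - \<alpha>) / 2)" for x
    proof (cases "u x - v x \<le> \<alpha>")
      case True
      then show ?thesis using le[of x] by (simp add: f_def)
    next
      case False
      then have fx: "u x = v x + \<alpha> + f x" "0 \<le> f x" by (simp_all add: f_def)
      have "0 \<le> (s - t) * f x" using st fx by simp
      then show ?thesis unfolding fx(1) by (simp add: field_simps)
    qed
    have "is_metric_projection M (C_dist M (ennreal \<alpha>)) (?U, ?V) (?P, ?Q)"
    proof (rule is_metric_projectionI)
      show "C_dist M (ennreal \<alpha>) \<subseteq> L2 M \<times> L2 M" by (auto simp: C_dist_def)
      have "\<bar>?P x - ?Q x\<bar> \<le> \<alpha>" for x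
      proof -
        have "((?U x + ?V x + \<alpha>) / 2) - ((?U x + ?V x - \<alpha>) / 2) = \<alpha>" by (simp add: field_simps)
        then show ?thesis using cases[of x] \<open>0 \<le> \<alpha>\<close> by (metis abs_of_nonneg order_refl)
      qed
      then show "(?P, ?Q) \<in> C_dist M (ennreal \<alpha>)" using L2 by (simp add: C_dist_def ennreal_leI)
      fix q q' assume "(q, q') \<in> C_dist M (ennreal \<alpha>)"
      then have "AE x in M. \<bar>q x - q' x\<bar> \<le> \<alpha>" using \<open>0 \<le> \<alpha>\<close> by (auto simp: C_dist_def)
      then show "AE x in M. (?U x - ?P x)\<^sup>2 + (?V x - ?Q x)\<^sup>2 \<le> (?U x - q x)\<^sup>2 + (?V x - q' x)\<^sup>2"
      proof eventually_elim
        case (elim x)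
        \<comment> \<open>The strip lies inside this half-plane, so minimality over the half-plane
          implies minimality over the strip.\<close>
        then have elim: "q x - q' x \<le> \<alpha>" by simp
        from cases[of x] show ?case
        proof
          assume "\<bar>?U x - ?V x\<bar> \<le> \<alpha> \<and> ?P x = ?U x \<and> ?Q x = ?V x"
          then show ?thesis by (metis add_nonneg_nonneg diff_self power_zero_numeral add_0 zero_le_power2)
        next
          assume "\<alpha> \<le> ?U x - ?V x \<and> ?P x = (?U x + ?V x + \<alpha>) / 2 \<and> ?Q x = (?U x + ?V x - \<alpha>) / 2"
          then show ?thesis using sq_dist_halfplane[OF elim, of "?U x" "?V x"] by metis
        qed
      qed
    qed (fact L2)+
    then show "E ?P + E ?Q \<le> E ?U + E ?V" by (rule Markov_dist[OF L2(1,2)])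
  qed
  also have "(\<lambda>x. u x - f x) = (\<lambda>x. min (u x) (v x + \<alpha>))" by (auto simp: f_def fun_eq_iff)
  also have "(\<lambda>x. v x + f x) = (\<lambda>x. max (v x) (u x - \<alpha>))" by (auto simp: f_def fun_eq_iff)
  finally show ?thesis .
qed

lemma D_leI: "w \<in> L2 M \<Longrightarrow> E w \<le> C \<Longrightarrow> C < \<infinity> \<Longrightarrow> w \<in> D"
  by (simp add: D_iff le_less_trans)

text \<open>The order assumption is removed in two moves: \<open>E_shift_ordered\<close> sends
  \<open>(u, w)\<close> to \<open>(h, w')\<close>, and \<open>E_min_max\<close> sends
  \<open>(v, w')\<close> to \<open>(w, k)\<close>. Adding, the finite energies of \<open>w\<close>
  and \<open>w'\<close> cancel. The functions \<open>h\<close> and \<open>k\<close> are given by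
  equations, so that each use can supply its own formula for them.\<close>

lemma E_shift:
  assumes u: "u \<in> L2 M" and v: "v \<in> L2 M" and "0 \<le> \<alpha>"
    and h: "\<And>x. h x = min (u x) (v x + \<alpha>)" and k: "\<And>x. k x = max (v x) (u x - \<alpha>)"
  shows "E h + E k \<le> E u + E v"
proof (cases "E u + E v = \<infinity>")
  case False
  define w w' where "w = (\<lambda>x. min (u x) (v x))" and "w' = (\<lambda>x. max (w x) (u x - \<alpha>))"
  have w: "w \<in> L2 M" unfolding w_def by (intro L2_intros u v)
  have w': "w' \<in> L2 M"
    by (rule L2_dominated[OF u w]) (use u w \<open>0 \<le> \<alpha>\<close> in \<open>auto simp: w'_def\<close>)
  have "E w \<le> E u + E v"
    using ennreal_add_leD(1)[OF E_min_max[OF u v]] by (simp only: w_def)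
  then have fin: "E w \<noteq> \<infinity>" using False by (auto simp: top_unique)
  have "(\<lambda>x. min (u x) (w x + \<alpha>)) = h" "(\<lambda>x. max (w x) (u x - \<alpha>)) = w'"
    using \<open>0 \<le> \<alpha>\<close> by (auto simp: fun_eq_iff h w_def w'_def)
  then have 1: "E h + E w' \<le> E u + E w"
    using E_shift_ordered[OF u w _ \<open>0 \<le> \<alpha>\<close>] by (simp add: w_def)
  have "(\<lambda>x. min (v x) (w' x)) = w" "(\<lambda>x. max (v x) (w' x)) = k"
    using \<open>0 \<le> \<alpha>\<close> by (auto simp: fun_eq_iff k w_def w'_def)
  then have 2: "E w + E k \<le> E v + E w'"
    using E_min_max[OF v w'] by simp
  have "E w' \<le> E u + E w" using 1 by (rule ennreal_add_leD)
  then have fin': "E w' \<noteq> \<infinity>" using False fin by (auto simp: top_unique)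
  have "E h + E k + (E w + E w') \<le> E u + E v + (E w + E w')"
    using add_mono[OF 1 2] by (simp add: ac_simps)
  then show ?thesis
    by (rule ennreal_add_right_le_cancel) (use fin fin' in simp)
next
  case True
  then show ?thesis by (simp only: infinity_ennreal_def top_greatest)
qed

section \<open>Truncations and stability of the domain\<close>

lemma E_split_le:
  assumes w: "w \<in> L2 M" and c: "0 \<le> c"
    and "\<And>x. a x = min (w x) c" "\<And>x. b x = max (w x - c) 0"
  shows "E a + E b \<le> E w"
  using E_shift[OF w L2_zero c, of a b] assms(3,4) by (simp add: zero max.commute)

lemma E_cut_le:
  assumes "w \<in> L2 M" "0 \<le> c" shows "E (\<lambda>x. min (w x) c) \<le> E w"
  by (rule ennreal_add_leD(1)[OF E_split_le[OF assms]]) auto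

lemma E_excess_le:
  assumes "w \<in> L2 M" "0 \<le> c" shows "E (\<lambda>x. max (w x - c) 0) \<le> E w"
  by (rule ennreal_add_leD(2)[OF E_split_le[OF assms]]) auto

lemma cut_D: "w \<in> D \<Longrightarrow> 0 \<le> c \<Longrightarrow> (\<lambda>x. min (w x) c) \<in> D"
  by (auto simp: D_iff L2_cut intro: le_less_trans[OF E_cut_le])

lemma excess_D: "w \<in> D \<Longrightarrow> 0 \<le> c \<Longrightarrow> (\<lambda>x. max (w x - c) 0) \<in> D"
  by (auto simp: D_iff L2_excess intro: le_less_trans[OF E_excess_le])

lemma pos_D: "w \<in> D \<Longrightarrow> (\<lambda>x. max (w x) 0) \<in> D"
  using excess_D[of w 0] by simp

lemma neg_D: "w \<in> D \<Longrightarrow> (\<lambda>x. max (- w x) 0) \<in> D"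
  by (rule pos_D[OF uminus_D])

lemma cut_below_D:
  assumes "w \<in> D" "0 \<le> c" shows "(\<lambda>x. max (w x) (- c)) \<in> D"
proof -
  have "(\<lambda>x. max (w x) (- c)) = (\<lambda>x. - min (- w x) c)" by auto
  then show ?thesis using uminus_D[OF cut_D[OF uminus_D]] assms by simp
qed

lemma min_max_D:
  assumes "u \<in> D" "v \<in> D"
  shows "(\<lambda>x. min (u x) (v x)) \<in> D" "(\<lambda>x. max (u x) (v x)) \<in> D"
proof -
  have L2: "u \<in> L2 M" "v \<in> L2 M" and fin: "E u + E v < \<infinity>" using assms by (auto simp: D_iff)
  have le: "E (\<lambda>x. min (u x) (v x)) + E (\<lambda>x. max (u x) (v x)) < \<infinity>"
    using E_min_max[OF L2] fin by (rule le_less_trans)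
  show "(\<lambda>x. min (u x) (v x)) \<in> D"
    by (rule D_leI[OF _ _ le]) (auto intro: L2_intros L2)
  show "(\<lambda>x. max (u x) (v x)) \<in> D"
    by (rule D_leI[OF _ _ le]) (auto intro: L2_intros L2)
qed

lemma shift_D:
  assumes u: "u \<in> D" and v: "v \<in> D" and "0 \<le> \<alpha>"
  shows "(\<lambda>x. min (u x) (v x + \<alpha>)) \<in> D" "(\<lambda>x. max (v x) (u x - \<alpha>)) \<in> D"
proof -
  have L2: "u \<in> L2 M" "v \<in> L2 M" and fin: "E u + E v < \<infinity>" using assms by (auto simp: D_iff)
  have "E (\<lambda>x. min (u x) (v x + \<alpha>)) + E (\<lambda>x. max (v x) (u x - \<alpha>)) \<le> E u + E v"
    by (rule E_shift[OF L2 \<open>0 \<le> \<alpha>\<close>]) auto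
  then have le: "E (\<lambda>x. min (u x) (v x + \<alpha>)) + E (\<lambda>x. max (v x) (u x - \<alpha>)) < \<infinity>"
    using fin by (rule le_less_trans)
  show "(\<lambda>x. min (u x) (v x + \<alpha>)) \<in> D"
    by (rule D_leI[OF L2_dominated[OF L2] _ le]) (use L2 \<open>0 \<le> \<alpha>\<close> in auto)
  show "(\<lambda>x. max (v x) (u x - \<alpha>)) \<in> D"
    by (rule D_leI[OF L2_dominated[OF L2] _ le]) (use L2 \<open>0 \<le> \<alpha>\<close> in auto)
qed

text \<open>Applied to the pair \<open>(- u, u)\<close> with shift \<open>2 * \<alpha>\<close>,
  \<open>E_shift\<close> returns \<open>- ?h\<close> and \<open>?h\<close>; by evenness this is
  twice the claim.\<close>

lemma E_fold_le:
  assumes u: "u \<in> L2 M" and "0 \<le> \<alpha>"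
  shows "E (\<lambda>x. \<bar>u x + \<alpha>\<bar> - \<alpha>) \<le> E u"
proof -
  let ?h = "\<lambda>x. \<bar>u x + \<alpha>\<bar> - \<alpha>"
  have h: "?h \<in> L2 M"
    by (rule L2_dominated1[OF u]) (use u \<open>0 \<le> \<alpha>\<close> in auto)
  have "E (\<lambda>x. - ?h x) + E ?h \<le> E (\<lambda>x. - u x) + E u"
    by (rule E_shift[OF L2_uminus[OF u] u, of "2 * \<alpha>"]) (use \<open>0 \<le> \<alpha>\<close> in auto)
  then have "E ?h + E ?h \<le> E u + E u" unfolding E_uminus[OF u] E_uminus[OF h] .
  then show ?thesis by (meson add_strict_mono leD leI)
qed

lemma fold_D: "u \<in> D \<Longrightarrow> 0 \<le> \<alpha> \<Longrightarrow> (\<lambda>x. \<bar>u x + \<alpha>\<bar> - \<alpha>) \<in> D"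
  by (rule D_leI[OF L2_dominated1 E_fold_le]) (auto simp: D_iff)

lemma convex_D:
  assumes "u \<in> D" "v \<in> D" "0 \<le> t" "t \<le> 1"
  shows "(\<lambda>x. (1 - t) * u x + t * v x) \<in> D"
proof (rule D_leI)
  show "(\<lambda>x. (1 - t) * u x + t * v x) \<in> L2 M" using assms by (intro L2_intros D_L2)
  show "E (\<lambda>x. (1 - t) * u x + t * v x) \<le> ennreal (1 - t) * E u + ennreal t * E v"
    using assms by (intro E_convex D_L2)
  show "ennreal (1 - t) * E u + ennreal t * E v < \<infinity>"
    using assms by (auto simp: D_iff ennreal_mult_less_top)
qed

text \<open>Convexity between 0 and \<open>w\<close>, with evenness for negative factors.\<close>

lemma E_scale_le:
  assumes w: "w \<in> L2 M" and "\<bar>\<sigma>\<bar> \<le> 1"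
  shows "E (\<lambda>x. \<sigma> * w x) \<le> E w"
proof -
  have le: "E (\<lambda>x. t * w x) \<le> E w" if "0 \<le> t" "t \<le> 1" for t
  proof -
    have "E (\<lambda>x. (1 - t) * 0 + t * w x) \<le> ennreal (1 - t) * E (\<lambda>x. 0) + ennreal t * E w"
      using w that by (intro E_convex L2_zero)
    also have "\<dots> \<le> 1 * E w"
      unfolding zero using that mult_right_mono[of "ennreal t" 1 "E w"] by (simp add: ennreal_le_1)
    finally show ?thesis by simp
  qed
  show ?thesis
  proof (cases "0 \<le> \<sigma>")
    case True
    then show ?thesis using le assms by simp
  next
    case False
    then show ?thesis using le[of "- \<sigma>"] E_uminus[OF L2_scale[OF w], of \<sigma>] assms by simp
  qed
qed

lemma E_cut_below_le:
  assumes w: "w \<in> L2 M" and c: "0 \<le> c"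
  shows "E (\<lambda>x. max (w x) (- c)) \<le> E w"
proof -
  have "(\<lambda>x. max (w x) (- c)) = (\<lambda>x. - min (- w x) c)" by auto
  moreover have "(\<lambda>x. min (- w x) c) \<in> L2 M" by (intro L2_intros w c)
  ultimately show ?thesis
    using E_cut_le[OF L2_uminus[OF w] c] by (simp add: E_uminus w)
qed

end

section \<open>Consequences of locality\<close>

locale local_Dirichlet = even_Dirichlet +
  assumes L0: "locality_L0 M E"
begin

section \<open>Energy is additive over horizontal layers\<close>

lemma E_fold: "u \<in> D \<Longrightarrow> 0 \<le> \<alpha> \<Longrightarrow> E (\<lambda>x. \<bar>u x + \<alpha>\<bar> - \<alpha>) = E u"
  using L0 by (simp add: locality_L0_def)

lemma E_fold_above:
  assumes u: "u \<in> D" and "0 \<le> \<alpha>" and h: "\<And>x. h x = \<alpha> - \<bar>u x - \<alpha>\<bar>"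
  shows "E h = E u"
proof -
  have "h = (\<lambda>x. - (\<bar>- u x + \<alpha>\<bar> - \<alpha>))" by (auto simp: h)
  then show ?thesis
    using E_fold[OF uminus_D[OF u] \<open>0 \<le> \<alpha>\<close>] E_uminus[OF D_L2[OF fold_D[OF uminus_D[OF u] \<open>0 \<le> \<alpha>\<close>]]]
      E_uminus[OF D_L2[OF u]] by simp
qed

text \<open>For the lower bound, \<open>E_shift\<close> applied to \<open>a\<close> and
  \<open>- b\<close> with shift \<open>c\<close> produces \<open>w\<close> folded down at height
  \<open>c\<close> together with 0; by locality folding leaves the energy of \<open>w\<close>
  unchanged.\<close>

lemma E_split:
  assumes w: "w \<in> D" and c: "0 \<le> c"
    and a: "\<And>x. a x = min (w x) c" and b: "\<And>x. b x = max (w x - c) 0"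
  shows "E a + E b = E w"
proof (rule antisym)
  show "E a + E b \<le> E w" by (rule E_split_le[OF D_L2[OF w] c a b])
  have a': "a = (\<lambda>x. min (w x) c)" and b': "b = (\<lambda>x. max (w x - c) 0)" using a b by auto
  have L2: "a \<in> L2 M" "b \<in> L2 M" unfolding a' b' by (intro L2_intros D_L2 w c)+
  have "E (\<lambda>x. c - \<bar>w x - c\<bar>) + E (\<lambda>x. 0) \<le> E a + E (\<lambda>x. - b x)"
    by (rule E_shift[OF L2(1) L2_uminus[OF L2(2)] c]) (use c in \<open>auto simp: a b\<close>)
  then show "E w \<le> E a + E b"
    using E_fold_above[OF w c refl] by (simp add: zero E_uminus L2)
qed

lemma E_pos_neg:
  assumes w: "w \<in> D"
  shows "E (\<lambda>x. max (w x) 0) + E (\<lambda>x. max (- w x) 0) = E w"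
proof -
  have "E (\<lambda>x. - min (w x) 0) = E (\<lambda>x. min (w x) 0)"
    by (rule E_uminus) (intro L2_intros D_L2 w order_refl)
  moreover have "(\<lambda>x. - min (w x) 0) = (\<lambda>x. max (- w x) 0)" by auto
  ultimately show ?thesis
    using E_split[OF w order_refl, of "\<lambda>x. min (w x) 0" "\<lambda>x. max (w x) 0"] by (simp add: add.commute)
qed

section \<open>Additivity for disjoint nonnegative functions\<close>

lemma E_add_of_diff_D:
  assumes fg: "(\<lambda>x. f x - g x) \<in> D" and nn: "\<And>x. 0 \<le> f x" "\<And>x. 0 \<le> g x" and disj: "\<And>x. f x * g x = 0"
  shows "E (\<lambda>x. f x + g x) = E f + E g"
proof -
  have c: "f x = 0 \<or> g x = 0" for x using disj[of x] by simp
  \<comment> \<open>The sum is the fold of \<open>f - g\<close> at level 0, and \<open>f\<close>,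
    \<open>g\<close> are its positive and negative parts.\<close>
  have "\<bar>f x - g x\<bar> = f x + g x" "max (f x - g x) 0 = f x" "max (g x - f x) 0 = g x" for x
    using nn[of x] c[of x] by auto
  then show ?thesis
    using E_fold[OF fg order_refl] E_pos_neg[OF fg] by simp
qed

text \<open>The summand \<open>g\<close> is shifted down by one layer, since \<open>min f \<epsilon> - min g' \<epsilon>\<close> lies in the domain
  for \<open>g' = max (g - \<epsilon>) 0\<close>, but not in general for \<open>g' = g\<close>.\<close>
lemma E_disjoint_shift:
  assumes "0 < \<epsilon>" "f \<in> D" "g \<in> D" "\<And>x. 0 \<le> f x" "\<And>x. 0 \<le> g x" "\<And>x. f x * g x = 0"
    and "\<And>x. f x \<le> real N * \<epsilon>"
  shows "E f + E (\<lambda>x. max (g x - \<epsilon>) 0) \<le> E (\<lambda>x. f x + max (g x - \<epsilon>) 0)"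
  using assms
proof (induction N arbitrary: f g)
  case 0
  then have "f = (\<lambda>x. 0)" by (auto simp: fun_eq_iff intro: antisym)
  then show ?case by (simp add: zero)
next
  case (Suc N)
  note nn = Suc.prems(4,5) and bound = Suc.prems(7)
  have c: "f x = 0 \<or> g x = 0" for x using Suc.prems(6)[of x] by simp
  define g' f' a b where "g' = (\<lambda>x. max (g x - \<epsilon>) 0)" and "f' = (\<lambda>x. max (f x - \<epsilon>) 0)"
    and "a = (\<lambda>x. min (f x) \<epsilon>)" and "b = (\<lambda>x. min (g' x) \<epsilon>)"
  have D: "g' \<in> D" "f' \<in> D" "a \<in> D" "b \<in> D"
    using Suc.prems by (auto simp: g'_def f'_def a_def b_def intro!: cut_D excess_D)
  \<comment> \<open>This function is \<open>a\<close> where \<open>g\<close> vanishes and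
    \<open>- g'\<close> where \<open>f\<close> vanishes; cutting it at \<open>- \<epsilon>\<close>
    then leaves \<open>a - b\<close>.\<close>
  have "(\<lambda>x. min (f x) (- g x + \<epsilon>)) \<in> D"
    using Suc.prems by (intro shift_D uminus_D) auto
  then have "(\<lambda>x. max (min (f x) (- g x + \<epsilon>)) (- \<epsilon>)) \<in> D"
    using \<open>0 < \<epsilon>\<close> by (intro cut_below_D) auto
  also have "(\<lambda>x. max (min (f x) (- g x + \<epsilon>)) (- \<epsilon>)) = (\<lambda>x. a x - b x)"
  proof
    show "max (min (f x) (- g x + \<epsilon>)) (- \<epsilon>) = a x - b x" for x
      using c[of x] nn[of x] \<open>0 < \<epsilon>\<close> by (auto simp: a_def b_def g'_def)
  qed
  finally have ab: "E (\<lambda>x. a x + b x) = E a + E b"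
  proof (rule E_add_of_diff_D)
    show "a x * b x = 0" for x
      using c[of x] \<open>0 < \<epsilon>\<close> by (auto simp: a_def b_def g'_def)
  qed (use nn \<open>0 < \<epsilon>\<close> in \<open>auto simp: a_def b_def g'_def\<close>)
  \<comment> \<open>Removing the bottom layer lowers the bound on \<open>f\<close> from
    \<open>Suc N\<close> to \<open>N\<close> layers.\<close>
  have IH: "E f' + E (\<lambda>x. max (g' x - \<epsilon>) 0) \<le> E (\<lambda>x. f' x + max (g' x - \<epsilon>) 0)"
  proof (rule Suc.IH[OF \<open>0 < \<epsilon>\<close> D(2,1)])
    show "f' x * g' x = 0" for x using c[of x] \<open>0 < \<epsilon>\<close> by (auto simp: f'_def g'_def)
    show "f' x \<le> real N * \<epsilon>" for x
      using bound[of x] \<open>0 < \<epsilon>\<close> by (auto simp: f'_def algebra_simps)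
  qed (auto simp: f'_def g'_def)
  have "E f + E g' = (E a + E f') + (E b + E (\<lambda>x. max (g' x - \<epsilon>) 0))"
    using E_split[OF Suc.prems(2), of \<epsilon> a f'] E_split[OF D(1), of \<epsilon> b "\<lambda>x. max (g' x - \<epsilon>) 0"]
      \<open>0 < \<epsilon>\<close> by (simp add: a_def b_def f'_def)
  also have "\<dots> = (E a + E b) + (E f' + E (\<lambda>x. max (g' x - \<epsilon>) 0))" by (simp add: ac_simps)
  also have "\<dots> \<le> E (\<lambda>x. a x + b x) + E (\<lambda>x. f' x + max (g' x - \<epsilon>) 0)"
    unfolding ab by (rule add_left_mono[OF IH])
  \<comment> \<open>By disjointness \<open>a + b\<close> and the remainder are the two layers of
    \<open>f + g'\<close> at height \<open>\<epsilon>\<close>.\<close>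
  also have "\<dots> \<le> E (\<lambda>x. f x + g' x)"
  proof (rule E_split_le)
    show "(\<lambda>x. f x + g' x) \<in> L2 M" using Suc.prems D by (auto intro: L2_intros D_L2)
    show "a x + b x = min (f x + g' x) \<epsilon>" for x
      using c[of x] nn[of x] \<open>0 < \<epsilon>\<close> by (auto simp: a_def b_def g'_def)
    show "f' x + max (g' x - \<epsilon>) 0 = max (f x + g' x - \<epsilon>) 0" for x
      using c[of x] nn[of x] \<open>0 < \<epsilon>\<close> by (auto simp: f'_def g'_def)
  qed (use \<open>0 < \<epsilon>\<close> in simp)
  finally show ?case by (simp add: g'_def)
qed

text \<open>The layer height \<open>K / (n + 1)\<close> lets \<open>n + 1\<close> layers cover
  \<open>f\<close>, and the shift of \<open>g\<close> disappears as \<open>n\<close> grows.\<close>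

lemma E_disjoint_bounded:
  assumes D: "f \<in> D" "g \<in> D" and nn: "\<And>x. 0 \<le> f x" "\<And>x. 0 \<le> g x" and disj: "\<And>x. f x * g x = 0"
    and K: "0 < K" "\<And>x. f x \<le> K"
  shows "E f + E g \<le> E (\<lambda>x. f x + g x)"
proof -
  define \<epsilon> where "\<epsilon> n = K / real (Suc n)" for n
  have \<epsilon>: "0 < \<epsilon> n" "real (Suc n) * \<epsilon> n = K" for n using K(1) by (simp_all add: \<epsilon>_def)
  have lim: "\<epsilon> \<longlonglongrightarrow> 0"
    unfolding \<epsilon>_def by (intro LIMSEQ_Suc lim_const_over_n)
  have L2: "f \<in> L2 M" "g \<in> L2 M" using D by (auto intro: D_L2)
  have le: "E (\<lambda>x. f x + min (g x) (\<epsilon> n)) + E (\<lambda>x. max (g x - \<epsilon> n) 0) \<le> E (\<lambda>x. f x + g x)" for n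
  proof -
    have "E (\<lambda>x. f x + min (g x) (\<epsilon> n)) + (E f + E (\<lambda>x. max (g x - \<epsilon> n) 0))
        \<le> E (\<lambda>x. f x + min (g x) (\<epsilon> n)) + E (\<lambda>x. f x + max (g x - \<epsilon> n) 0)"
      using \<epsilon>(1) K(2) by (intro add_left_mono E_disjoint_shift[where N="Suc n"] D nn disj) (simp_all only: \<epsilon>(2))
    \<comment> \<open>The shift by \<open>\<epsilon> n\<close> of the pair \<open>(f + g, f)\<close>
      returns these two functions; the extra \<open>E f\<close> cancels against the one from
      \<open>E_disjoint_shift\<close>.\<close>
    also have "\<dots> \<le> E (\<lambda>x. f x + g x) + E f"
      by (rule E_shift[OF L2_add[OF L2] L2(1) less_imp_le[OF \<epsilon>(1)[of n]]]) (auto simp: min_def max_def)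
    finally have "E (\<lambda>x. f x + min (g x) (\<epsilon> n)) + E (\<lambda>x. max (g x - \<epsilon> n) 0) + E f \<le> E (\<lambda>x. f x + g x) + E f"
      by (simp add: ac_simps)
    then show ?thesis by (rule ennreal_add_right_le_cancel[OF _ D_neq_top[OF D(1)]])
  qed
  show ?thesis
  proof (rule E_add_limit[OF L2(2) _ _ _ _ L2(2) _ _ _ _ le])
    show "(\<lambda>n. f x + min (g x) (\<epsilon> n)) \<longlonglongrightarrow> f x" for x
      using nn(2)[of x] by (auto intro!: tendsto_eq_intros lim)
    show "(\<lambda>n. max (g x - \<epsilon> n) 0) \<longlonglongrightarrow> g x" for x
      using nn(2)[of x] by (auto intro!: tendsto_eq_intros lim)
    show "\<bar>f x + min (g x) (\<epsilon> n) - f x\<bar> \<le> \<bar>g x\<bar>" for n x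
      using nn(2)[of x] \<epsilon>(1)[of n] by auto
    show "\<bar>max (g x - \<epsilon> n) 0 - g x\<bar> \<le> \<bar>g x\<bar>" for n x
      using nn(2)[of x] \<epsilon>(1)[of n] by auto
  qed (use L2 \<epsilon>(1) in \<open>auto intro!: L2_intros less_imp_le\<close>)
qed

text \<open>The upper bound is \<open>E_min_max\<close>, since the minimum vanishes. The lower bound
  follows from the bounded case by truncating both functions.\<close>

lemma E_disjoint_add:
  assumes D: "f \<in> D" "g \<in> D" and nn: "\<And>x. 0 \<le> f x" "\<And>x. 0 \<le> g x" and disj: "\<And>x. f x * g x = 0"
  shows "E (\<lambda>x. f x + g x) = E f + E g"
proof (rule antisym)
  have L2: "f \<in> L2 M" "g \<in> L2 M" using D by (auto intro: D_L2)
  have c: "f x = 0 \<or> g x = 0" for x using disj[of x] by simp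
  have "max (f x) (g x) = f x + g x" "min (f x) (g x) = 0" for x using c[of x] nn[of x] by auto
  then show "E (\<lambda>x. f x + g x) \<le> E f + E g" using E_min_max[OF L2] by (simp add: zero)
  let ?c = "\<lambda>n. real (Suc n)"
  have le: "E (\<lambda>x. min (f x) (?c n)) + E (\<lambda>x. min (g x) (?c n)) \<le> E (\<lambda>x. f x + g x)" for n
  proof -
    have "E (\<lambda>x. min (f x) (?c n)) + E (\<lambda>x. min (g x) (?c n))
        \<le> E (\<lambda>x. min (f x) (?c n) + min (g x) (?c n))"
    proof (rule E_disjoint_bounded[where K="?c n"])
      show "min (f x) (?c n) * min (g x) (?c n) = 0" for x using c[of x] by auto
    qed (use nn D in \<open>auto intro: cut_D\<close>)
    also have "(\<lambda>x. min (f x) (?c n) + min (g x) (?c n)) = (\<lambda>x. min (f x + g x) (?c n))"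
    proof
      show "min (f x) (?c n) + min (g x) (?c n) = min (f x + g x) (?c n)" for x
        using c[of x] nn[of x] by auto
    qed
    also have "E \<dots> \<le> E (\<lambda>x. f x + g x)"
      by (rule E_cut_le) (auto intro: L2_intros L2)
    finally show ?thesis .
  qed
  have lim: "(\<lambda>n. min r (?c n)) \<longlonglongrightarrow> r" for r :: real
  proof (rule tendsto_eventually)
    obtain m where "r \<le> real m" using real_arch_simple by blast
    then have "min r (?c n) = r" if "n \<ge> m" for n using that by (simp add: min_def)
    then show "\<forall>\<^sub>F n in sequentially. min r (?c n) = r" by (rule eventually_sequentiallyI)
  qed
  show "E f + E g \<le> E (\<lambda>x. f x + g x)"
  proof (rule E_add_limit[OF L2(1) _ _ _ lim L2(2) _ _ _ lim le])
    show "\<bar>min (f x) (?c n) - f x\<bar> \<le> \<bar>f x\<bar>" for n x using nn(1)[of x] by auto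
    show "\<bar>min (g x) (?c n) - g x\<bar> \<le> \<bar>g x\<bar>" for n x using nn(2)[of x] by auto
  qed (use L2 in \<open>auto intro: L2_cut\<close>)
qed

section \<open>Subtraction where the maximum level is attained\<close>

lemma E_descend_shift:
  assumes "0 < \<epsilon>" "u \<in> D" "v \<in> D" "\<And>x. 0 \<le> v x" "\<And>x. u x \<le> real N * \<epsilon>"
    and "\<And>x. (u x - real N * \<epsilon>) * v x = 0"
  shows "E u + E (\<lambda>x. max (v x - \<epsilon>) 0) \<le> E (\<lambda>x. u x - max (v x - \<epsilon>) 0)"
  using assms
\<comment> \<open>Each step removes the top layer \<open>a\<close> of \<open>u\<close> and the
  bottom layer \<open>b\<close> of \<open>v'\<close>. At \<open>N = 0\<close>, \<open>- u\<close>
  and \<open>v\<close> are disjoint and nonnegative.\<close>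
proof (induction N arbitrary: u v)
  case 0
  have v': "(\<lambda>x. max (v x - \<epsilon>) 0) \<in> D" using 0 by (intro excess_D) auto
  have c: "u x = 0 \<or> v x = 0" for x using 0(6)[of x] by auto
  have "E (\<lambda>x. - u x + max (v x - \<epsilon>) 0) = E (\<lambda>x. - u x) + E (\<lambda>x. max (v x - \<epsilon>) 0)"
  proof (rule E_disjoint_add[OF uminus_D[OF 0(2)] v'])
    show "- u x * max (v x - \<epsilon>) 0 = 0" for x using c[of x] \<open>0 < \<epsilon>\<close> by auto
  qed (use 0 in auto)
  moreover have "E (\<lambda>x. - (u x - max (v x - \<epsilon>) 0)) = E (\<lambda>x. u x - max (v x - \<epsilon>) 0)"
    by (rule E_uminus) (intro L2_diff D_L2 0 v')
  moreover have "(\<lambda>x. - (u x - max (v x - \<epsilon>) 0)) = (\<lambda>x. - u x + max (v x - \<epsilon>) 0)" by auto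
  ultimately show ?case using 0 by (simp add: E_uminus D_L2)
next
  case (Suc N)
  define c where "c = real N * \<epsilon>"
  have c0: "0 \<le> c" using \<open>0 < \<epsilon>\<close> by (simp add: c_def)
  have Sc: "real (Suc N) * \<epsilon> = c + \<epsilon>" by (simp add: c_def algebra_simps)
  note le = Suc.prems(5)[unfolded Sc] and nn = Suc.prems(4)
  have cc: "u x = c + \<epsilon> \<or> v x = 0" for x using Suc.prems(6)[of x, unfolded Sc] by simp
  define v' u' a b where "v' = (\<lambda>x. max (v x - \<epsilon>) 0)" and "u' = (\<lambda>x. min (u x) c)"
    and "a = (\<lambda>x. max (u x - c) 0)" and "b = (\<lambda>x. min (v' x) \<epsilon>)"
  have D: "u \<in> D" "v \<in> D" "v' \<in> D" "u' \<in> D" "a \<in> D" "b \<in> D"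
    using Suc.prems c0 by (auto simp: v'_def u'_def a_def b_def intro!: cut_D excess_D)
  have IH: "E u' + E (\<lambda>x. max (v' x - \<epsilon>) 0) \<le> E (\<lambda>x. u' x - max (v' x - \<epsilon>) 0)"
  proof (rule Suc.IH[OF \<open>0 < \<epsilon>\<close> D(4,3)])
    show "(u' x - real N * \<epsilon>) * v' x = 0" for x
      using cc[of x] \<open>0 < \<epsilon>\<close> by (auto simp: u'_def v'_def c_def[symmetric])
  qed (auto simp: u'_def v'_def c_def)
  \<comment> \<open>Where \<open>v\<close> is nonzero, \<open>a\<close> equals
    \<open>\<epsilon>\<close>, so the capped maximum is \<open>\<epsilon>\<close> plus one layer of
    \<open>v'\<close>. The shift from \<open>v\<close> to \<open>v'\<close> is what makes this
    identity hold.\<close>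
  have "(\<lambda>x. min (max (v x) (a x)) (2 * \<epsilon>)) \<in> D"
    using D \<open>0 < \<epsilon>\<close> by (intro cut_D min_max_D) auto
  also have "(\<lambda>x. min (max (v x) (a x)) (2 * \<epsilon>)) = (\<lambda>x. a x + b x)"
  proof
    show "min (max (v x) (a x)) (2 * \<epsilon>) = a x + b x" for x
      using cc[of x] le[of x] nn[of x] \<open>0 < \<epsilon>\<close> by (auto simp: a_def b_def v'_def)
  qed
  finally have ab: "(\<lambda>x. a x + b x) \<in> D" .
  have "E a + E b \<le> E (\<lambda>x. a x + b x)"
  proof (rule E_split_le[OF D_L2[OF ab], of \<epsilon>])
    show "a x = min (a x + b x) \<epsilon>" "b x = max (a x + b x - \<epsilon>) 0" for x
      using cc[of x] le[of x] nn[of x] \<open>0 < \<epsilon>\<close> by (auto simp: a_def b_def v'_def)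
  qed (use \<open>0 < \<epsilon>\<close> in simp)
  \<comment> \<open>\<open>b\<close> sits on top of \<open>a\<close> at height
    \<open>\<epsilon>\<close>, so folding down there changes the sign of \<open>b\<close>
    only.\<close>
  also have "\<dots> = E (\<lambda>x. a x - b x)"
  proof (rule E_fold_above[OF ab, of \<epsilon>, symmetric])
    show "a x - b x = \<epsilon> - \<bar>a x + b x - \<epsilon>\<bar>" for x
      using cc[of x] le[of x] nn[of x] \<open>0 < \<epsilon>\<close> by (auto simp: a_def b_def v'_def)
  qed (use \<open>0 < \<epsilon>\<close> in simp)
  finally have ab_le: "E a + E b \<le> E (\<lambda>x. a x - b x)" .
  have "E u + E v' = (E u' + E a) + (E b + E (\<lambda>x. max (v' x - \<epsilon>) 0))"
    using E_split[OF D(1) c0, of u' a] E_split[OF D(3), of \<epsilon> b "\<lambda>x. max (v' x - \<epsilon>) 0"] \<open>0 < \<epsilon>\<close>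
    by (simp add: u'_def a_def b_def)
  also have "\<dots> = (E u' + E (\<lambda>x. max (v' x - \<epsilon>) 0)) + (E a + E b)" by (simp add: ac_simps)
  also have "\<dots> \<le> E (\<lambda>x. u' x - max (v' x - \<epsilon>) 0) + E (\<lambda>x. a x - b x)"
    by (rule add_mono[OF IH ab_le])
  \<comment> \<open>The two differences are the layers of \<open>u - v'\<close> below and above
    \<open>c\<close>.\<close>
  also have "\<dots> \<le> E (\<lambda>x. u x - v' x)"
  proof (rule E_split_le[OF _ c0])
    show "(\<lambda>x. u x - v' x) \<in> L2 M" using D by (auto intro: L2_intros D_L2)
    show "u' x - max (v' x - \<epsilon>) 0 = min (u x - v' x) c" "a x - b x = max (u x - v' x - c) 0" for x
      using cc[of x] le[of x] nn[of x] \<open>0 < \<epsilon>\<close> by (auto simp: u'_def a_def b_def v'_def)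
  qed
  finally show ?case by (simp add: v'_def)
qed

text \<open>One inequality is \<open>E_shift\<close> for \<open>(u, - v)\<close> with shift
  \<open>c\<close>, whose second output is 0. The other removes the shift in
  \<open>E_descend_shift\<close> by letting the layer height \<open>c / (n + 1)\<close> tend to 0;
  the level \<open>c = 0\<close> leaves no layers and is plain disjointness.\<close>

lemma E_descend:
  assumes D: "u \<in> D" "v \<in> D" and nn: "\<And>x. 0 \<le> v x" and c: "0 \<le> c" "\<And>x. u x \<le> c"
    and disj: "\<And>x. (u x - c) * v x = 0"
  shows "E (\<lambda>x. u x - v x) = E u + E v"
proof (rule antisym)
  have L2: "u \<in> L2 M" "v \<in> L2 M" using D by (auto intro: D_L2)
  have cc: "u x = c \<or> v x = 0" for x using disj[of x] by simp
  have "E (\<lambda>x. u x - v x) + E (\<lambda>x. 0) \<le> E u + E (\<lambda>x. - v x)"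
  proof (rule E_shift[OF L2(1) L2_uminus[OF L2(2)] c(1)])
    show "u x - v x = min (u x) (- v x + c)" "0 = max (- v x) (u x - c)" for x
      using cc[of x] c(2)[of x] nn[of x] by auto
  qed
  then show "E (\<lambda>x. u x - v x) \<le> E u + E v" by (simp add: zero E_uminus L2)
  show "E u + E v \<le> E (\<lambda>x. u x - v x)"
  proof (cases "c = 0")
    case True
    have "E (\<lambda>x. - u x + v x) = E (\<lambda>x. - u x) + E v"
      using disj nn c True by (intro E_disjoint_add uminus_D D) auto
    moreover have "E (\<lambda>x. - (u x - v x)) = E (\<lambda>x. u x - v x)"
      by (rule E_uminus) (intro L2_diff L2)
    moreover have "(\<lambda>x. - (u x - v x)) = (\<lambda>x. - u x + v x)" by auto
    ultimately show ?thesis by (simp add: E_uminus L2)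
  next
    case False
    then have "0 < c" using c by simp
    define \<epsilon> where "\<epsilon> n = c / real (Suc n)" for n
    have \<epsilon>: "0 < \<epsilon> n" "real (Suc n) * \<epsilon> n = c" for n using \<open>0 < c\<close> by (simp_all add: \<epsilon>_def)
    have lim: "\<epsilon> \<longlonglongrightarrow> 0"
      unfolding \<epsilon>_def by (intro LIMSEQ_Suc lim_const_over_n)
    have le: "E (\<lambda>x. u x - min (v x) (\<epsilon> n)) + E (\<lambda>x. max (v x - \<epsilon> n) 0) \<le> E (\<lambda>x. u x - v x)" for n
    proof -
      have "E u + E (\<lambda>x. max (v x - \<epsilon> n) 0) + E (\<lambda>x. u x - min (v x) (\<epsilon> n))
          \<le> E (\<lambda>x. u x - max (v x - \<epsilon> n) 0) + E (\<lambda>x. u x - min (v x) (\<epsilon> n))"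
        using \<epsilon>(1) c(2) disj
        by (intro add_right_mono E_descend_shift[where N="Suc n"] D nn) (simp_all only: \<epsilon>(2))
      \<comment> \<open>The pair \<open>(u, u - v)\<close> shifted by \<open>\<epsilon> n\<close>
        returns both functions on the left.\<close>
      also have "\<dots> \<le> E u + E (\<lambda>x. u x - v x)"
        by (rule E_shift[OF L2(1) L2_diff[OF L2] less_imp_le[OF \<epsilon>(1)[of n]]]) (auto simp: min_def max_def)
      finally have "E (\<lambda>x. u x - min (v x) (\<epsilon> n)) + E (\<lambda>x. max (v x - \<epsilon> n) 0) + E u \<le> E (\<lambda>x. u x - v x) + E u"
        by (simp add: ac_simps)
      then show ?thesis by (rule ennreal_add_right_le_cancel[OF _ D_neq_top[OF D(1)]])
    qed
    show ?thesis
    proof (rule E_add_limit[OF L2(2) _ _ _ _ L2(2) _ _ _ _ le])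
      show "(\<lambda>n. u x - min (v x) (\<epsilon> n)) \<longlonglongrightarrow> u x" for x
        using nn[of x] by (auto intro!: tendsto_eq_intros lim)
      show "(\<lambda>n. max (v x - \<epsilon> n) 0) \<longlonglongrightarrow> v x" for x
        using nn[of x] by (auto intro!: tendsto_eq_intros lim)
      show "\<bar>u x - min (v x) (\<epsilon> n) - u x\<bar> \<le> \<bar>v x\<bar>" for n x
        using nn[of x] \<epsilon>(1)[of n] by auto
      show "\<bar>max (v x - \<epsilon> n) 0 - v x\<bar> \<le> \<bar>v x\<bar>" for n x
        using nn[of x] \<epsilon>(1)[of n] by auto
    qed (use L2 \<epsilon>(1) in \<open>auto intro!: L2_intros less_imp_le\<close>)
  qed
qed

section \<open>Additivity across a level, then normal contractions\<close>

lemma E_add_nonneg_level: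
  assumes D: "u \<in> D" "v \<in> D" "(\<lambda>x. u x + v x) \<in> D" and c: "0 \<le> c"
    and disj: "\<And>x. (u x - c) * v x = 0"
  shows "E (\<lambda>x. u x + v x) = E u + E v"
proof -
  have cc: "u x = c \<or> v x = 0" for x using disj[of x] by simp
  let ?p = "\<lambda>x. max (v x) 0" and ?n = "\<lambda>x. max (- v x) 0"
  let ?e = "\<lambda>x. max (u x - c) 0" and ?c = "\<lambda>x. min (u x) c"
  have D': "?p \<in> D" "?n \<in> D" "?e \<in> D" "?c \<in> D"
    using D c by (auto intro: pos_D neg_D cut_D excess_D)
  \<comment> \<open>Split the sum at height \<open>c\<close>: below it only the negative part of
    \<open>v\<close> acts, as a descent from the top level of \<open>?c\<close>; above it the
    positive part is disjoint from \<open>?e\<close>.\<close>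
  have "E (\<lambda>x. u x + v x) = E (\<lambda>x. ?c x - ?n x) + E (\<lambda>x. ?e x + ?p x)"
  proof (rule E_split[OF D(3) c, symmetric])
    show "?c x - ?n x = min (u x + v x) c" "?e x + ?p x = max (u x + v x - c) 0" for x
      using cc[of x] by auto
  qed
  also have "E (\<lambda>x. ?c x - ?n x) = E ?c + E ?n"
  proof (rule E_descend[OF D'(4,2) _ c])
    show "(?c x - c) * ?n x = 0" for x using cc[of x] by auto
  qed auto
  also have "E (\<lambda>x. ?e x + ?p x) = E ?e + E ?p"
  proof (rule E_disjoint_add[OF D'(3,1)])
    show "?e x * ?p x = 0" for x using cc[of x] by auto
  qed auto
  also have "E ?c + E ?n + (E ?e + E ?p) = (E ?c + E ?e) + (E ?p + E ?n)"
    by (simp add: ac_simps)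
  also have "\<dots> = E u + E v"
    using E_split[OF D(1) c, of ?c ?e] E_pos_neg[OF D(2)] by simp
  finally show ?thesis .
qed

lemma E_add_pointwise:
  assumes D: "u \<in> D" "v \<in> D" "(\<lambda>x. u x + v x) \<in> D" and disj: "\<And>x. (u x - c) * v x = 0"
  shows "E (\<lambda>x. u x + v x) = E u + E v"
proof (cases "0 \<le> c")
  case True
  then show ?thesis using E_add_nonneg_level[OF D _ disj] by simp
next
  case False
  have D': "(\<lambda>x. - u x + - v x) \<in> D" using uminus_D[OF D(3)] by simp
  have "E (\<lambda>x. - u x + - v x) = E (\<lambda>x. - u x) + E (\<lambda>x. - v x)"
  proof (rule E_add_nonneg_level[OF uminus_D[OF D(1)] uminus_D[OF D(2)] D', of "- c"])
    show "(- u x - - c) * - v x = 0" for x using disj[of x] by auto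
  qed (use False in simp)
  then show ?thesis using E_uminus[OF D_L2[OF D(3)]] by (simp add: E_uminus D_L2 D)
qed

text \<open>Changing \<open>v\<close> on a null set makes the level condition hold
  everywhere.\<close>

lemma E_add:
  assumes D: "u \<in> D" "v \<in> D" "(\<lambda>x. u x + v x) \<in> D" and disj: "AE x in M. (u x - c) * v x = 0"
  shows "E (\<lambda>x. u x + v x) = E u + E v"
proof -
  define v' where "v' = (\<lambda>x. if (u x - c) * v x = 0 then v x else 0)"
  have L2: "u \<in> L2 M" "v \<in> L2 M" using D by (auto intro: D_L2)
  have v': "v' \<in> L2 M"
    unfolding v'_def by (rule L2_dominated1[OF L2(2)]) (use L2 in auto)
  have ae: "AE x in M. v' x = v x" using disj by eventually_elim (simp add: v'_def)
  have eq: "E v' = E v" using v' L2(2) ae by (rule E_cong_AE)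
  have eq': "E (\<lambda>x. u x + v' x) = E (\<lambda>x. u x + v x)"
    by (rule E_cong_AE) (use L2 v' ae in \<open>auto intro: L2_add\<close>)
  have "E (\<lambda>x. u x + v' x) = E u + E v'"
  proof (rule E_add_pointwise[of _ _ c])
    show "(\<lambda>x. u x + v' x) \<in> D" "v' \<in> D"
      using D eq eq' v' L2 by (auto simp: D_iff intro: L2_add)
  qed (use D in \<open>auto simp: v'_def\<close>)
  then show ?thesis by (simp add: eq eq')
qed

text \<open>A working class for the approximation argument: it contains 0, is closed under
  reflection of the argument and under linear continuation, with slope in \<open>[-1, 1]\<close>,
  beyond any \<open>r \<ge> 0\<close>.\<close>

definition energy_contractions :: "(real \<Rightarrow> real) set" where
  "energy_contractions =
    {\<theta> \<in> contractions. \<theta> 0 = 0 \<and> (\<forall>u\<in>D. E (\<lambda>x. \<theta> (u x)) \<le> E u)}"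

lemma energy_contractionsD:
  assumes "\<theta> \<in> energy_contractions"
  shows "\<theta> \<in> contractions" "\<theta> 0 = 0" "u \<in> D \<Longrightarrow> E (\<lambda>x. \<theta> (u x)) \<le> E u"
    "u \<in> D \<Longrightarrow> (\<lambda>x. \<theta> (u x)) \<in> D"
proof -
  show *: "\<theta> \<in> contractions" "\<theta> 0 = 0" "u \<in> D \<Longrightarrow> E (\<lambda>x. \<theta> (u x)) \<le> E u"
    using assms by (auto simp: energy_contractions_def)
  show "(\<lambda>x. \<theta> (u x)) \<in> D" if "u \<in> D"
    using *(3)[OF that] that by (auto simp: D_iff intro: L2_contraction *(1,2) le_less_trans)
qed

text \<open>The delicate point is membership in the domain: for \<open>\<sigma> = 1\<close> the new function is
  \<open>max A (u - (r - \<theta> r))\<close> with \<open>A = \<theta> (min u r)\<close>, the case \<open>\<sigma> = -1\<close> is symmetric, and the general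
  case follows by convexity.\<close>
lemma energy_contractions_extend:
  assumes \<theta>: "\<theta> \<in> energy_contractions" and r: "0 \<le> r" and \<sigma>: "\<bar>\<sigma>\<bar> \<le> 1"
  shows "(\<lambda>s. \<theta> (min s r) + \<sigma> * max (s - r) 0) \<in> energy_contractions"
proof -
  note c = contractionsD[OF energy_contractionsD(1)[OF \<theta>]]
  have \<theta>0: "\<theta> 0 = 0" using \<theta> by (rule energy_contractionsD)
  have "\<bar>(\<theta> (min s r) + \<sigma> * max (s - r) 0) - (\<theta> (min t r) + \<sigma> * max (t - r) 0)\<bar> \<le> \<bar>s - t\<bar>" for s t
  proof -
    have "\<bar>\<sigma> * max (s - r) 0 - \<sigma> * max (t - r) 0\<bar> = \<bar>\<sigma>\<bar> * \<bar>max (s - r) 0 - max (t - r) 0\<bar>"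
      by (simp only: abs_mult right_diff_distrib flip: abs_mult)
    also have "\<dots> \<le> 1 * \<bar>max (s - r) 0 - max (t - r) 0\<bar>"
      using \<sigma> by (intro mult_right_mono) auto
    finally have 1: "\<bar>\<sigma> * max (s - r) 0 - \<sigma> * max (t - r) 0\<bar> \<le> \<bar>max (s - r) 0 - max (t - r) 0\<bar>"
      by simp
    have 2: "\<bar>min s r - min t r\<bar> + \<bar>max (s - r) 0 - max (t - r) 0\<bar> = \<bar>s - t\<bar>" by auto
    have "\<bar>(\<theta> (min s r) + \<sigma> * max (s - r) 0) - (\<theta> (min t r) + \<sigma> * max (t - r) 0)\<bar>
        \<le> \<bar>\<theta> (min s r) - \<theta> (min t r)\<bar> + \<bar>\<sigma> * max (s - r) 0 - \<sigma> * max (t - r) 0\<bar>"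
      by (rule abs_diff_triangle_ineq)
    also have "\<dots> \<le> \<bar>s - t\<bar>"
      using add_mono[OF c[of "min s r" "min t r"] 1] unfolding 2 .
    finally show ?thesis .
  qed
  moreover have "E (\<lambda>x. \<theta> (min (u x) r) + \<sigma> * max (u x - r) 0) \<le> E u" if u: "u \<in> D" for u
  proof -
    let ?A = "\<lambda>x. \<theta> (min (u x) r)" and ?B = "\<lambda>x. max (u x - r) 0"
    have A: "?A \<in> D" and B: "?B \<in> D"
      using u r by (auto intro: energy_contractionsD(4)[OF \<theta>] cut_D excess_D)
    \<comment> \<open>Left of \<open>r\<close> the contraction bound makes the maximum below select
      \<open>?A\<close>; right of \<open>r\<close> it selects the continuation with slope 1, or -1
      after the sign change.\<close>
    have ext: "\<theta> (min (u x) r) \<ge> u x - (r - \<theta> r) \<or> (u x \<ge> r)" "- \<theta> (min (u x) r) \<ge> u x - (r + \<theta> r) \<or> (u x \<ge> r)" for x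
      using c[of "u x" r] by auto
    have \<alpha>: "0 \<le> r - \<theta> r" "0 \<le> r + \<theta> r" using c[of r 0] r \<theta>0 by auto
    have "(\<lambda>x. max (?A x) (u x - (r - \<theta> r))) \<in> D"
      using A u \<alpha> by (intro shift_D(2))
    also have "(\<lambda>x. max (?A x) (u x - (r - \<theta> r))) = (\<lambda>x. ?A x + ?B x)"
    proof
      show "max (?A x) (u x - (r - \<theta> r)) = ?A x + ?B x" for x
        using ext(1)[of x] by (auto simp: min_def max_def)
    qed
    finally have plus: "(\<lambda>x. ?A x + ?B x) \<in> D" .
    have "(\<lambda>x. - max (- ?A x) (u x - (r + \<theta> r))) \<in> D"
      using A u \<alpha> by (intro uminus_D shift_D(2))
    also have "(\<lambda>x. - max (- ?A x) (u x - (r + \<theta> r))) = (\<lambda>x. ?A x - ?B x)"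
    proof
      show "- max (- ?A x) (u x - (r + \<theta> r)) = ?A x - ?B x" for x
        using ext(2)[of x] by (auto simp: min_def max_def)
    qed
    finally have minus: "(\<lambda>x. ?A x - ?B x) \<in> D" .
    \<comment> \<open>This weight makes the convex combination of slopes -1 and 1 equal to
      \<open>\<sigma>\<close>.\<close>
    define t where "t = (1 + \<sigma>) / 2"
    have "(\<lambda>x. (1 - t) * (?A x - ?B x) + t * (?A x + ?B x)) \<in> D"
      using \<sigma> by (intro convex_D plus minus) (auto simp: t_def)
    also have "(\<lambda>x. (1 - t) * (?A x - ?B x) + t * (?A x + ?B x)) = (\<lambda>x. ?A x + \<sigma> * ?B x)"
      by (auto simp: t_def field_simps)
    finally have sum: "(\<lambda>x. ?A x + \<sigma> * ?B x) \<in> D" .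
    have \<sigma>B: "(\<lambda>x. \<sigma> * ?B x) \<in> D"
      using E_scale_le[OF D_L2[OF B] \<sigma>] B by (auto simp: D_iff intro: L2_scale le_less_trans)
    \<comment> \<open>Wherever \<open>?B\<close> is nonzero, \<open>?A\<close> has the constant
      value \<open>\<theta> r\<close>, which serves as the level.\<close>
    have "E (\<lambda>x. ?A x + \<sigma> * ?B x) = E ?A + E (\<lambda>x. \<sigma> * ?B x)"
    proof (rule E_add_pointwise[OF A \<sigma>B sum, of "\<theta> r"])
      show "(?A x - \<theta> r) * (\<sigma> * ?B x) = 0" for x by (auto simp: min_def max_def)
    qed
    also have "\<dots> \<le> E (\<lambda>x. min (u x) r) + E ?B"
      using u r by (intro add_mono energy_contractionsD(3)[OF \<theta>] E_scale_le[OF D_L2[OF B] \<sigma>] cut_D)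
    also have "\<dots> \<le> E u" by (rule E_split_le[OF D_L2[OF u] r]) auto
    finally show ?thesis .
  qed
  ultimately show ?thesis
    using r \<theta>0 by (simp add: energy_contractions_def contractions_def)
qed

lemma energy_contractions_reflect:
  assumes "\<theta> \<in> energy_contractions"
  shows "(\<lambda>s. \<theta> (- s)) \<in> energy_contractions"
proof -
  have "E (\<lambda>x. \<theta> (- u x)) \<le> E u" if "u \<in> D" for u
    using energy_contractionsD(3)[OF assms uminus_D[OF that]] E_uminus[OF D_L2[OF that]] by simp
  moreover have "\<bar>\<theta> (- s) - \<theta> (- t)\<bar> \<le> \<bar>s - t\<bar>" for s t
    using contractionsD[OF energy_contractionsD(1)[OF assms], of "- s" "- t"] by simp
  ultimately show ?thesis
    using energy_contractionsD(2)[OF assms] by (simp add: energy_contractions_def contractions_def)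
qed

text \<open>Interpolation one cell at a time, with \<open>\<sigma>\<close> the slope of
  \<open>\<theta>\<close> across the new cell. Preserving \<open>\<eta>\<close> left of 0 allows the
  two half-lines to be treated in turn.\<close>

lemma energy_contractions_grid_extend:
  assumes \<theta>: "\<theta> \<in> contractions" "\<theta> 0 = 0" and \<eta>: "\<eta> \<in> energy_contractions" and "0 < \<epsilon>"
  shows "\<exists>\<eta>'\<in>energy_contractions.
    (\<forall>j\<le>k. \<eta>' (real j * \<epsilon>) = \<theta> (real j * \<epsilon>)) \<and> (\<forall>s\<le>0. \<eta>' s = \<eta> s)"
proof (induction k)
  case 0
  show ?case using \<eta> \<theta>(2) energy_contractionsD(2)[OF \<eta>] by auto
next
  case (Suc k)
  then obtain \<eta>' where \<eta>': "\<eta>' \<in> energy_contractions"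
      "\<And>j. j \<le> k \<Longrightarrow> \<eta>' (real j * \<epsilon>) = \<theta> (real j * \<epsilon>)" "\<And>s. s \<le> 0 \<Longrightarrow> \<eta>' s = \<eta> s"
    by auto
  define r \<sigma> where "r = real k * \<epsilon>" and "\<sigma> = (\<theta> (r + \<epsilon>) - \<theta> r) / \<epsilon>"
  have r: "0 \<le> r" using \<open>0 < \<epsilon>\<close> by (simp add: r_def)
  have "\<bar>\<theta> (r + \<epsilon>) - \<theta> r\<bar> \<le> \<epsilon>" using contractionsD[OF \<theta>(1), of "r + \<epsilon>" r] \<open>0 < \<epsilon>\<close> by simp
  then have \<sigma>: "\<bar>\<sigma>\<bar> \<le> 1" using \<open>0 < \<epsilon>\<close> by (simp add: \<sigma>_def)
  let ?\<eta> = "\<lambda>s. \<eta>' (min s r) + \<sigma> * max (s - r) 0"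
  have "?\<eta> (real j * \<epsilon>) = \<theta> (real j * \<epsilon>)" if "j \<le> Suc k" for j
  proof (cases "j = Suc k")
    case True
    then have "real j * \<epsilon> = r + \<epsilon>" by (simp add: r_def algebra_simps)
    then show ?thesis using \<eta>'(2)[of k] \<open>0 < \<epsilon>\<close> by (simp add: \<sigma>_def r_def)
  next
    case False
    then have "j \<le> k" using that by simp
    moreover from this have "real j * \<epsilon> \<le> r" using \<open>0 < \<epsilon>\<close> by (simp add: r_def)
    ultimately show ?thesis using \<eta>'(2)[of j] by simp
  qed
  moreover have "?\<eta> s = \<eta> s" if "s \<le> 0" for s
    using that r \<eta>'(3)[OF that] by simp
  ultimately show ?case
    using energy_contractions_extend[OF \<eta>'(1) r \<sigma>] by (intro bexI[of _ ?\<eta>]) auto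
qed

text \<open>Interpolate the reflected function to the right of 0, reflect, then interpolate
  \<open>\<theta>\<close> to the right of 0. Off the grid each of the two contractions moves by at
  most \<open>\<epsilon>\<close>, hence the error \<open>2 * \<epsilon>\<close>.\<close>

lemma energy_contractions_approx:
  assumes \<theta>: "\<theta> \<in> contractions" "\<theta> 0 = 0" and "0 < \<epsilon>"
  shows "\<exists>\<eta>\<in>energy_contractions. \<forall>s. \<bar>s\<bar> \<le> real k * \<epsilon> \<longrightarrow> \<bar>\<eta> s - \<theta> s\<bar> \<le> 2 * \<epsilon>"
proof -
  have refl: "(\<lambda>s. \<theta> (- s)) \<in> contractions"
    unfolding contractions_def
  proof (clarify)
    show "\<bar>\<theta> (- s) - \<theta> (- t)\<bar> \<le> \<bar>s - t\<bar>" for s t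
      using contractionsD[OF \<theta>(1), of "- s" "- t"] by linarith
  qed
  have "(\<lambda>s. 0) \<in> energy_contractions"
    by (simp add: energy_contractions_def contractions_def zero)
  from energy_contractions_grid_extend[OF refl _ this \<open>0 < \<epsilon>\<close>, of k] obtain \<eta>1 where
    \<eta>1: "\<eta>1 \<in> energy_contractions" "\<And>j. j \<le> k \<Longrightarrow> \<eta>1 (real j * \<epsilon>) = \<theta> (- (real j * \<epsilon>))"
    using \<theta>(2) by auto
  from energy_contractions_grid_extend[OF \<theta> energy_contractions_reflect[OF \<eta>1(1)] \<open>0 < \<epsilon>\<close>, of k]
  obtain \<eta> where \<eta>: "\<eta> \<in> energy_contractions" "\<And>j. j \<le> k \<Longrightarrow> \<eta> (real j * \<epsilon>) = \<theta> (real j * \<epsilon>)"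
    "\<And>s. s \<le> 0 \<Longrightarrow> \<eta> s = \<eta>1 (- s)"
    by auto
  have neg: "\<eta> (- (real j * \<epsilon>)) = \<theta> (- (real j * \<epsilon>))" if "j \<le> k" for j
    using \<eta>(3)[of "- (real j * \<epsilon>)"] \<eta>1(2)[OF that] \<open>0 < \<epsilon>\<close> by simp
  have near: "\<bar>\<eta> s - \<theta> s\<bar> \<le> 2 * \<epsilon>" if "\<eta> t = \<theta> t" "\<bar>s - t\<bar> \<le> \<epsilon>" for s t
    using contractionsD[OF energy_contractionsD(1)[OF \<eta>(1)], of s t] contractionsD[OF \<theta>(1), of s t] that
    by linarith
  have "\<bar>\<eta> s - \<theta> s\<bar> \<le> 2 * \<epsilon>" if s: "\<bar>s\<bar> \<le> real k * \<epsilon>" for s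
  proof -
    define j where "j = nat \<lfloor>\<bar>s\<bar> / \<epsilon>\<rfloor>"
    have fl: "real j = of_int \<lfloor>\<bar>s\<bar> / \<epsilon>\<rfloor>" using \<open>0 < \<epsilon>\<close> by (simp add: j_def)
    have "real j \<le> \<bar>s\<bar> / \<epsilon>" "\<bar>s\<bar> / \<epsilon> < real j + 1" unfolding fl by linarith+
    then have j: "real j * \<epsilon> \<le> \<bar>s\<bar>" "\<bar>s\<bar> < real j * \<epsilon> + \<epsilon>"
      using \<open>0 < \<epsilon>\<close> by (simp_all add: field_simps)
    have "real j * \<epsilon> \<le> real k * \<epsilon>" using j(1) s by linarith
    then have "j \<le> k" using \<open>0 < \<epsilon>\<close> by simp
    show ?thesis
    proof (cases "0 \<le> s")
      case True
      then show ?thesis using near[OF \<eta>(2)[OF \<open>j \<le> k\<close>], of s] j by simp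
    next
      case False
      then show ?thesis using near[OF neg[OF \<open>j \<le> k\<close>], of s] j by simp
    qed
  qed
  then show ?thesis using \<eta>(1) by blast
qed

lemma E_contraction:
  assumes \<theta>: "\<theta> \<in> contractions" "\<theta> 0 = 0" and u: "u \<in> D"
  shows "E (\<lambda>x. \<theta> (u x)) \<le> E u"
proof -
  let ?\<epsilon> = "\<lambda>n. 1 / real (Suc n)"
  have "\<exists>\<eta>\<in>energy_contractions. \<forall>s. \<bar>s\<bar> \<le> real (Suc n) \<longrightarrow> \<bar>\<eta> s - \<theta> s\<bar> \<le> 2 * ?\<epsilon> n" for n
  proof -
    \<comment> \<open>With mesh \<open>1 / (n + 1)\<close>, \<open>(n + 1)\<^sup>2\<close> cells on
      each side reach out to \<open>n + 1\<close>, so the grid refines and exhausts the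
      line.\<close>
    have "real (Suc n * Suc n) * ?\<epsilon> n = real (Suc n)"
      unfolding of_nat_mult by (simp del: of_nat_Suc)
    moreover have "0 < ?\<epsilon> n" by simp
    ultimately show ?thesis using energy_contractions_approx[OF \<theta>, of "?\<epsilon> n" "Suc n * Suc n"] by metis
  qed
  then obtain \<eta> where \<eta>: "\<And>n. \<eta> n \<in> energy_contractions"
    "\<And>n s. \<bar>s\<bar> \<le> real (Suc n) \<Longrightarrow> \<bar>\<eta> n s - \<theta> s\<bar> \<le> 2 * ?\<epsilon> n"
    by metis
  have lim: "(\<lambda>n. \<eta> n s) \<longlonglongrightarrow> \<theta> s" for s
  proof (rule LIM_zero_cancel, rule tendsto_rabs_zero_cancel, rule tendsto_sandwich[OF _ _ tendsto_const])
    obtain m where "\<bar>s\<bar> \<le> real m" using real_arch_simple by blast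
    then have "\<bar>\<eta> n s - \<theta> s\<bar> \<le> 2 * ?\<epsilon> n" if "n \<ge> m" for n
      using that by (intro \<eta>(2)) simp
    then show "\<forall>\<^sub>F n in sequentially. \<bar>\<eta> n s - \<theta> s\<bar> \<le> 2 * ?\<epsilon> n"
      by (rule eventually_sequentiallyI)
    show "(\<lambda>n. 2 * ?\<epsilon> n) \<longlonglongrightarrow> 0"
      by (intro tendsto_mult_right_zero LIMSEQ_Suc lim_const_over_n)
  qed simp
  have bound: "\<bar>\<xi> s\<bar> \<le> \<bar>s\<bar>" if "\<xi> \<in> contractions" "\<xi> 0 = 0" for \<xi> s
    using contractionsD[OF that(1), of s 0] that(2) by simp
  show ?thesis
  proof (rule E_limit[OF L2_scale[OF D_L2[OF u], of 2] _ _ _ lim])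
    show "\<bar>\<eta> n (u x) - \<theta> (u x)\<bar> \<le> \<bar>2 * u x\<bar>" for n x
      using bound[OF \<theta>, of "u x"] bound[OF energy_contractionsD(1,2)[OF \<eta>(1)], of n "u x"]
      unfolding abs_mult by arith
    show "E (\<lambda>x. \<eta> n (u x)) \<le> E u" for n by (rule energy_contractionsD(3)[OF \<eta>(1) u])
    show "(\<lambda>x. \<eta> n (u x)) \<in> L2 M" for n
      by (rule L2_contraction[OF D_L2[OF u] energy_contractionsD(1,2)[OF \<eta>(1)]])
  qed (rule D_L2[OF u] L2_contraction[OF D_L2[OF u] \<theta>])+
qed

section \<open>The other locality properties from folding invariance\<close>

lemma contraction_D: "\<theta> \<in> contractions \<Longrightarrow> \<theta> 0 = 0 \<Longrightarrow> u \<in> D \<Longrightarrow> (\<lambda>x. \<theta> (u x)) \<in> D"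
  by (rule D_leI[OF L2_contraction E_contraction]) (auto simp: D_iff)

lemma locality_L1: "locality_L1 M E"
  unfolding locality_L1_def using E_add by blast

text \<open>Form of \<open>E_add\<close> for decompositions that are valid only almost
  everywhere.\<close>

lemma E_add_AE:
  assumes D: "u \<in> D" "v \<in> D" "w \<in> D"
    and ae: "AE x in M. w x = u x + v x \<and> (u x - c) * v x = 0"
  shows "E w = E u + E v"
proof -
  have L2: "w \<in> L2 M" "(\<lambda>x. u x + v x) \<in> L2 M" using D by (auto intro: L2_add D_L2)
  have eq: "E w = E (\<lambda>x. u x + v x)"
    using ae by (intro E_cong_AE L2) auto
  moreover have "(\<lambda>x. u x + v x) \<in> D" using D(3) L2(2) eq by (simp add: D_iff)
  ultimately show ?thesis using E_add[OF D(1,2), of c] ae by auto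
qed

text \<open>Split \<open>u\<close> at \<open>\<bar>c\<bar>\<close> and \<open>- v\<close> at
  \<open>m = \<bar>c\<bar> - c\<close>, the height beyond which \<open>v + \<bar>c\<bar>\<close>
  falls below \<open>c\<close>. Then \<open>h_plus\<close> joins the lower part of \<open>u\<close>
  to the upper part of \<open>- v\<close> along level \<open>c\<close>, and \<open>k_plus\<close>
  joins the other two, which are disjoint.\<close>

lemma E_h_k_plus:
  assumes u: "u \<in> D" and v: "v \<in> D" and ae: "AE x in M. (u x - c) * v x = 0"
  shows "E (\<lambda>x. h_plus \<bar>c\<bar> (u x) (v x)) + E (\<lambda>x. k_plus \<bar>c\<bar> (u x) (v x)) = E u + E v"
proof -
  define m where "m = \<bar>c\<bar> - c"
  have m: "0 \<le> m" by (simp add: m_def)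
  let ?A = "\<lambda>x. min (u x) \<bar>c\<bar>" and ?A' = "\<lambda>x. max (u x - \<bar>c\<bar>) 0"
  let ?B = "\<lambda>x. - max (- v x - m) 0" and ?B' = "\<lambda>x. - min (- v x) m"
  have D: "?A \<in> D" "?A' \<in> D" "(\<lambda>x. max (- v x - m) 0) \<in> D" "(\<lambda>x. min (- v x) m) \<in> D"
    using u v m by (auto intro!: cut_D excess_D uminus_D)
  have h: "E (\<lambda>x. h_plus \<bar>c\<bar> (u x) (v x)) = E ?A + E ?B"
  proof (rule E_add_AE[OF D(1) uminus_D[OF D(3)], of _ c])
    show "(\<lambda>x. h_plus \<bar>c\<bar> (u x) (v x)) \<in> D"
      unfolding h_plus_def using u v by (intro shift_D) auto
    show "AE x in M. h_plus \<bar>c\<bar> (u x) (v x) = ?A x + ?B x \<and> (?A x - c) * ?B x = 0"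
      using ae
    proof eventually_elim
      case (elim x)
      then have "u x = c \<or> v x = 0" by auto
      then show ?case by (auto simp: h_plus_def m_def)
    qed
  qed
  have k: "E (\<lambda>x. k_plus \<bar>c\<bar> (u x) (v x)) = E ?A' + E ?B'"
  proof (rule E_add_AE[OF D(2) uminus_D[OF D(4)], of _ 0])
    show "(\<lambda>x. k_plus \<bar>c\<bar> (u x) (v x)) \<in> D"
      unfolding k_plus_def using u v by (intro shift_D) auto
    show "AE x in M. k_plus \<bar>c\<bar> (u x) (v x) = ?A' x + ?B' x \<and> (?A' x - 0) * ?B' x = 0"
      using ae
    proof eventually_elim
      case (elim x)
      then have "u x = c \<or> v x = 0" by auto
      then show ?case by (auto simp: k_plus_def m_def)
    qed
  qed
  have "E (\<lambda>x. h_plus \<bar>c\<bar> (u x) (v x)) + E (\<lambda>x. k_plus \<bar>c\<bar> (u x) (v x))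
      = (E ?A + E ?A') + (E (\<lambda>x. min (- v x) m) + E (\<lambda>x. max (- v x - m) 0))"
    unfolding h k E_uminus[OF D_L2[OF D(3)]] E_uminus[OF D_L2[OF D(4)]] by (simp only: ac_simps)
  also have "E ?A + E ?A' = E u" by (rule E_split[OF u]) auto
  also have "E (\<lambda>x. min (- v x) m) + E (\<lambda>x. max (- v x - m) 0) = E (\<lambda>x. - v x)"
    by (rule E_split[OF uminus_D[OF v] m]) auto
  also have "\<dots> = E v" by (rule E_uminus[OF D_L2[OF v]])
  finally show ?thesis .
qed

lemma E_h_k_minus:
  assumes u: "u \<in> D" and v: "v \<in> D" and ae: "AE x in M. (u x - c) * v x = 0"
  shows "E (\<lambda>x. h_minus \<bar>c\<bar> (u x) (v x)) + E (\<lambda>x. k_minus \<bar>c\<bar> (u x) (v x)) = E u + E v"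
proof -
  have h: "(\<lambda>x. h_minus \<bar>c\<bar> (u x) (v x)) = (\<lambda>x. - h_plus \<bar>c\<bar> (- u x) (- v x))"
    by (auto simp: h_minus_def h_plus_def)
  have k: "(\<lambda>x. k_minus \<bar>c\<bar> (u x) (v x)) = (\<lambda>x. - k_plus \<bar>c\<bar> (- u x) (- v x))"
    by (auto simp: k_minus_def k_plus_def)
  have "(\<lambda>x. h_plus \<bar>c\<bar> (- u x) (- v x)) \<in> D" "(\<lambda>x. k_plus \<bar>c\<bar> (- u x) (- v x)) \<in> D"
    unfolding h_plus_def k_plus_def by (intro shift_D uminus_D u v abs_ge_zero)+
  then have "E (\<lambda>x. h_minus \<bar>c\<bar> (u x) (v x)) + E (\<lambda>x. k_minus \<bar>c\<bar> (u x) (v x))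
      = E (\<lambda>x. h_plus \<bar>- c\<bar> (- u x) (- v x)) + E (\<lambda>x. k_plus \<bar>- c\<bar> (- u x) (- v x))"
    unfolding h k by (simp add: E_uminus D_L2)
  also have "\<dots> = E (\<lambda>x. - u x) + E (\<lambda>x. - v x)"
    by (rule E_h_k_plus[OF uminus_D[OF u] uminus_D[OF v]]) (use ae in \<open>eventually_elim, auto\<close>)
  finally show ?thesis by (simp add: E_uminus D_L2 u v)
qed

lemma E_max_min_disjoint:
  assumes u: "u \<in> D" and v: "v \<in> D" and ae: "AE x in M. u x * v x = 0"
  shows "E (\<lambda>x. max (u x) (v x)) + E (\<lambda>x. min (u x) (v x)) = E u + E v"
proof -
  let ?n = "\<lambda>w x. max (- w x) (0 :: real)"
  have max: "E (\<lambda>x. max (u x) (v x)) = E (\<lambda>x. max (u x) 0) + E (\<lambda>x. max (v x) 0)"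
  proof (rule E_add_AE[OF pos_D[OF u] pos_D[OF v] min_max_D(2)[OF u v], of 0])
    show "AE x in M. max (u x) (v x) = max (u x) 0 + max (v x) 0 \<and> (max (u x) 0 - 0) * max (v x) 0 = 0"
      using ae by eventually_elim auto
  qed
  have min: "E (\<lambda>x. min (u x) (v x)) = E (\<lambda>x. - ?n u x) + E (\<lambda>x. - ?n v x)"
  proof (rule E_add_AE[OF uminus_D[OF neg_D[OF u]] uminus_D[OF neg_D[OF v]] min_max_D(1)[OF u v], of 0])
    show "AE x in M. min (u x) (v x) = - ?n u x + - ?n v x \<and> (- ?n u x - 0) * - ?n v x = 0"
      using ae by eventually_elim auto
  qed
  have "E (\<lambda>x. max (u x) (v x)) + E (\<lambda>x. min (u x) (v x))
      = (E (\<lambda>x. max (u x) 0) + E (?n u)) + (E (\<lambda>x. max (v x) 0) + E (?n v))"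
    unfolding max min E_uminus[OF D_L2[OF neg_D[OF u]]] E_uminus[OF D_L2[OF neg_D[OF v]]]
    by (simp only: ac_simps)
  then show ?thesis by (simp only: E_pos_neg[OF u] E_pos_neg[OF v])
qed

lemma locality_L2: "locality_L2 M E"
  unfolding locality_L2_def using E_max_min_disjoint E_h_k_plus E_h_k_minus by blast

lemma locality_L3: "locality_L3 M E"
  unfolding locality_L3_def
proof (intro ballI impI)
  fix u \<phi> \<psi> assume u: "u \<in> D" and \<phi>: "\<phi> \<in> contractions" and \<psi>: "\<psi> \<in> contractions"
    and disj: "supp \<phi> \<inter> supp \<psi> = {}"
  note D = contraction_D[OF recentre_contractions[OF \<phi>] _ u] contraction_D[OF recentre_contractions[OF \<psi>] _ u]
  have sum: "(\<lambda>x. recentre \<phi> (u x) + recentre \<psi> (u x)) \<in> D"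
    by (rule contraction_D[OF contractions_add_disjoint_supp[OF \<phi> \<psi> disj] _ u]) simp
  moreover have "E (\<lambda>x. recentre \<phi> (u x) + recentre \<psi> (u x)) = E (\<lambda>x. recentre \<phi> (u x)) + E (\<lambda>x. recentre \<psi> (u x))"
  \<comment> \<open>At 0 at least one function vanishes. If it is \<open>\<psi>\<close>, then
    wherever \<open>\<psi> (u x)\<close> is nonzero the recentred \<open>\<phi>\<close> equals
    \<open>- \<phi> 0\<close>, which is the level; the other case is symmetric.\<close>
  proof (cases "\<psi> 0 = 0")
    case True
    have "(recentre \<phi> (u x) - - \<phi> 0) * recentre \<psi> (u x) = 0" for x
      using supp_disjointD[OF disj, of "u x"] True by (auto simp: recentre_def)
    then show ?thesis using D sum by (intro E_add_pointwise[of _ _ "- \<phi> 0"]) simp_all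
  next
    case False
    then have "\<phi> 0 = 0" using supp_disjointD[OF disj, of 0] by simp
    then have "(recentre \<psi> (u x) - - \<psi> 0) * recentre \<phi> (u x) = 0" for x
      using supp_disjointD[OF disj, of "u x"] by (auto simp: recentre_def)
    moreover have "(\<lambda>x. recentre \<psi> (u x) + recentre \<phi> (u x)) \<in> D" using sum by (simp add: add.commute)
    ultimately have "E (\<lambda>x. recentre \<psi> (u x) + recentre \<phi> (u x)) = E (\<lambda>x. recentre \<psi> (u x)) + E (\<lambda>x. recentre \<phi> (u x))"
      using D by (intro E_add_pointwise[of _ _ "- \<psi> 0"]) simp_all
    then show ?thesis by (simp add: add.commute)
  qed
  ultimately show "(\<lambda>x. recentre \<phi> (u x) + recentre \<psi> (u x)) \<in> D \<and>
      E (\<lambda>x. recentre \<phi> (u x) + recentre \<psi> (u x)) = E (\<lambda>x. recentre \<phi> (u x)) + E (\<lambda>x. recentre \<psi> (u x))"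
    by blast
qed

end

section \<open>The equivalence\<close>

context even_Dirichlet
begin

text \<open>Wherever \<open>?b\<close> is nonzero, \<open>?a\<close> equals
  \<open>- \<alpha>\<close>, so \<open>- \<alpha>\<close> is the level for both \<open>?b\<close>
  and \<open>- ?b\<close>; evenness identifies the two sums.\<close>

lemma locality_L0_if_L1:
  assumes "locality_L1 M E"
  shows "locality_L0 M E"
  unfolding locality_L0_def
proof (intro ballI allI impI)
  fix u and \<alpha> :: real assume u: "u \<in> D" and \<alpha>: "0 \<le> \<alpha>"
  let ?a = "\<lambda>x. max (u x) (- \<alpha>)" and ?b = "\<lambda>x. max (- u x - \<alpha>) 0"
  have D: "?a \<in> D" "?b \<in> D" using u \<alpha> by (auto intro!: cut_below_D excess_D uminus_D)
  have eq: "(\<lambda>x. \<bar>u x + \<alpha>\<bar> - \<alpha>) = (\<lambda>x. ?a x + ?b x)" "u = (\<lambda>x. ?a x + - ?b x)"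
    by (auto simp: fun_eq_iff)
  have L1: "E (\<lambda>x. f x + g x) = E f + E g"
    if "f \<in> D" "g \<in> D" "(\<lambda>x. f x + g x) \<in> D" "\<And>x. (f x - - \<alpha>) * g x = 0" for f g
  proof -
    have "AE x in M. (f x - - \<alpha>) * g x = 0" using that(4) by (rule AE_I2)
    then show ?thesis using assms that(1-3) unfolding locality_L1_def by blast
  qed
  have "E (\<lambda>x. \<bar>u x + \<alpha>\<bar> - \<alpha>) = E ?a + E ?b"
    unfolding eq(1) by (rule L1[OF D fold_D[OF u \<alpha>, unfolded eq(1)]]) auto
  also have "\<dots> = E ?a + E (\<lambda>x. - ?b x)" by (simp only: E_uminus[OF D_L2[OF D(2)]])
  also have "\<dots> = E (\<lambda>x. ?a x + - ?b x)"
    by (rule L1[OF D(1) uminus_D[OF D(2)], symmetric]) (use u eq(2) in auto)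
  also have "\<dots> = E u" using eq(2) by simp
  finally show "E (\<lambda>x. \<bar>u x + \<alpha>\<bar> - \<alpha>) = E u" .
qed

text \<open>Two uses of the minus identity: the pair \<open>(u, 0)\<close> at level
  \<open>\<alpha>\<close> yields \<open>?a\<close> and \<open>- ?b\<close>, and the pair
  \<open>(?a, ?b)\<close> at level \<open>- \<alpha>\<close> yields the folded function and
  0.\<close>

lemma locality_L0_if_L2:
  assumes "locality_L2 M E"
  shows "locality_L0 M E"
  unfolding locality_L0_def
proof (intro ballI allI impI)
  fix u and \<alpha> :: real assume u: "u \<in> D" and \<alpha>: "0 \<le> \<alpha>"
  have L2: "E (\<lambda>x. h_minus \<bar>c\<bar> (f x) (g x)) + E (\<lambda>x. k_minus \<bar>c\<bar> (f x) (g x)) = E f + E g"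
    if "f \<in> D" "g \<in> D" "\<And>x. (f x - c) * g x = 0" for f g c
    using assms that unfolding locality_L2_def by (meson AE_I2)
  let ?a = "\<lambda>x. max (u x) (- \<alpha>)" and ?b = "\<lambda>x. max (- u x - \<alpha>) 0"
  have D: "?a \<in> D" "?b \<in> D" using u \<alpha> by (auto intro!: cut_below_D excess_D uminus_D)
  have "(\<lambda>x. h_minus \<bar>\<alpha>\<bar> (u x) 0) = ?a" "(\<lambda>x. k_minus \<bar>\<alpha>\<bar> (u x) 0) = (\<lambda>x. - ?b x)"
    using \<alpha> by (auto simp: h_minus_def k_minus_def)
  then have "E ?a + E ?b = E u"
    using L2[OF u zero_D, of \<alpha>] E_uminus[OF D_L2[OF D(2)]] by (simp add: zero)
  moreover have "(\<lambda>x. h_minus \<bar>- \<alpha>\<bar> (?a x) (?b x)) = (\<lambda>x. \<bar>u x + \<alpha>\<bar> - \<alpha>)"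
    "(\<lambda>x. k_minus \<bar>- \<alpha>\<bar> (?a x) (?b x)) = (\<lambda>x. 0)"
    using \<alpha> by (auto simp: fun_eq_iff h_minus_def k_minus_def)
  moreover have "(?a x - - \<alpha>) * ?b x = 0" for x by auto
  ultimately show "E (\<lambda>x. \<bar>u x + \<alpha>\<bar> - \<alpha>) = E u"
    using L2[OF D, of "- \<alpha>"] by (simp add: zero)
qed

lemma locality_L0_if_L3:
  assumes "locality_L3 M E"
  shows "locality_L0 M E"
  unfolding locality_L0_def
proof (intro ballI allI impI, rule antisym)
  fix u and \<alpha> :: real assume u: "u \<in> D" and \<alpha>: "0 \<le> \<alpha>"
  show "E (\<lambda>x. \<bar>u x + \<alpha>\<bar> - \<alpha>) \<le> E u" by (rule E_fold_le[OF D_L2[OF u] \<alpha>])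
  define w where "w = (\<lambda>x. \<bar>u x + \<alpha>\<bar> - \<alpha>)"
  have w: "w \<in> D" unfolding w_def by (rule fold_D[OF u \<alpha>])
  \<comment> \<open>The two pieces of \<open>u\<close> on either side of \<open>- \<alpha>\<close>,
    separated by a gap of width \<open>2 * \<epsilon>\<close> so that the supports are disjoint;
    \<open>f\<close> is already recentred.\<close>
  define f where "f \<epsilon> s = max (s + \<alpha> - \<epsilon>) 0 - max (\<alpha> - \<epsilon>) 0" for \<epsilon> s
  define g where "g \<epsilon> s = max (- s - \<alpha> - \<epsilon>) 0" for \<epsilon> s
  have L2: "(\<lambda>x. f \<epsilon> (u x)) \<in> L2 M" "(\<lambda>x. g \<epsilon> (u x)) \<in> L2 M" if "0 < \<epsilon>" for \<epsilon>
    using that \<alpha> by (auto simp: f_def g_def contractions_def intro!: L2_contraction[OF D_L2[OF u]])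
  have le: "E (\<lambda>x. f \<epsilon> (u x) - g \<epsilon> (u x)) \<le> E w" if "0 < \<epsilon>" for \<epsilon>
  proof -
    define \<phi> \<psi> \<psi>' :: "real \<Rightarrow> real" where
      "\<phi> = (\<lambda>s. max (s + \<alpha> - \<epsilon>) 0)" and "\<psi> = g \<epsilon>" and "\<psi>' = (\<lambda>s. - g \<epsilon> s)"
    have c: "\<phi> \<in> contractions" "\<psi> \<in> contractions" "\<psi>' \<in> contractions"
      by (auto simp: contractions_def \<phi>_def \<psi>_def \<psi>'_def g_def)
    have "supp \<phi> \<subseteq> {- \<alpha> + \<epsilon>..}" "supp \<psi> \<subseteq> {..- \<alpha> - \<epsilon>}" "supp \<psi>' \<subseteq> {..- \<alpha> - \<epsilon>}"
      unfolding supp_def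
      by (rule closure_minimal; auto simp: \<phi>_def \<psi>_def \<psi>'_def g_def max_def split: if_splits)+
    moreover have "{- \<alpha> + \<epsilon>..} \<inter> {..- \<alpha> - \<epsilon>} = {}" using that by auto
    ultimately have disj: "supp \<phi> \<inter> supp \<psi> = {}" "supp \<phi> \<inter> supp \<psi>' = {}" by blast+
    have rec: "recentre \<phi> = f \<epsilon>" "recentre \<psi> = g \<epsilon>" "recentre \<psi>' = (\<lambda>s. - g \<epsilon> s)"
      using \<alpha> that by (auto simp: recentre_def \<phi>_def \<psi>_def \<psi>'_def f_def g_def)
    have "E (\<lambda>x. f \<epsilon> (u x) + - g \<epsilon> (u x)) = E (\<lambda>x. f \<epsilon> (u x)) + E (\<lambda>x. - g \<epsilon> (u x))"
      using assms u c disj(2) unfolding locality_L3_def rec(1)[symmetric] rec(3)[symmetric, THEN fun_cong] by blast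
    also have "\<dots> = E (\<lambda>x. f \<epsilon> (u x)) + E (\<lambda>x. g \<epsilon> (u x))"
      by (simp only: E_uminus[OF L2(2)[OF that]])
    also have "\<dots> = E (\<lambda>x. f \<epsilon> (u x) + g \<epsilon> (u x))"
      using assms u c disj(1) unfolding locality_L3_def rec(1,2)[symmetric] by metis
    \<comment> \<open>The sum is a truncation of \<open>w\<close>: a cut from below if the gap stays
      left of 0, an excess if it reaches beyond 0.\<close>
    also have "\<dots> \<le> E w"
    proof (cases "\<epsilon> \<le> \<alpha>")
      case True
      have "(\<lambda>x. f \<epsilon> (u x) + g \<epsilon> (u x)) = (\<lambda>x. max (w x) (- (\<alpha> - \<epsilon>)))"
        using that True by (auto simp: fun_eq_iff f_def g_def w_def)
      then show ?thesis using E_cut_below_le[OF D_L2[OF w], of "\<alpha> - \<epsilon>"] True by simp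
    next
      case False
      have "(\<lambda>x. f \<epsilon> (u x) + g \<epsilon> (u x)) = (\<lambda>x. max (w x - (\<epsilon> - \<alpha>)) 0)"
        using that False by (auto simp: fun_eq_iff f_def g_def w_def)
      then show ?thesis using E_excess_le[OF D_L2[OF w], of "\<epsilon> - \<alpha>"] False by simp
    qed
    finally show ?thesis by simp
  qed
  define \<epsilon> where "\<epsilon> n = 1 / real (Suc n)" for n
  have \<epsilon>: "0 < \<epsilon> n" for n by (simp add: \<epsilon>_def)
  have lim: "\<epsilon> \<longlonglongrightarrow> 0" unfolding \<epsilon>_def by (intro LIMSEQ_Suc lim_const_over_n)
  show "E u \<le> E (\<lambda>x. \<bar>u x + \<alpha>\<bar> - \<alpha>)"
    unfolding w_def[symmetric]
  proof (rule E_limit[OF L2_scale[OF D_L2[OF u], of 3] _ D_L2[OF u] _ _ le[OF \<epsilon>]])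
    show "(\<lambda>x. f (\<epsilon> n) (u x) - g (\<epsilon> n) (u x)) \<in> L2 M" for n
      by (intro L2_diff L2 \<epsilon>)
    show "\<bar>f (\<epsilon> n) (u x) - g (\<epsilon> n) (u x) - u x\<bar> \<le> \<bar>3 * u x\<bar>" for n x
      using \<epsilon>[of n] \<alpha> by (auto simp: f_def g_def max_def abs_if)
    show "(\<lambda>n. f (\<epsilon> n) (u x) - g (\<epsilon> n) (u x)) \<longlonglongrightarrow> u x" for x
    proof -
      have "(\<lambda>n. f (\<epsilon> n) (u x) - g (\<epsilon> n) (u x)) \<longlonglongrightarrow>
          max (u x + \<alpha> - 0) 0 - max (\<alpha> - 0) 0 - max (- u x - \<alpha> - 0) 0"
        unfolding f_def g_def by (intro tendsto_intros lim)
      moreover have "max (u x + \<alpha> - 0) 0 - max (\<alpha> - 0) 0 - max (- u x - \<alpha> - 0) 0 = u x"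
        using \<alpha> by auto
      ultimately show ?thesis by (simp only:)
    qed
  qed
qed

end

theorem theorem1p2:
  fixes M :: "'a measure" and E :: "('a \<Rightarrow> real) \<Rightarrow> ennreal"
  assumes "sigma_finite_measure M"
    and "Dirichlet_functional M E"
    and "even_functional M E"
    and "E (\<lambda>x. 0) = 0"
  shows "(locality_L0 M E \<longleftrightarrow> locality_L1 M E) \<and>
         (locality_L1 M E \<longleftrightarrow> locality_L2 M E) \<and>
         (locality_L2 M E \<longleftrightarrow> locality_L3 M E)"
proof -
  interpret even_Dirichlet M E
    using assms(2-4) by unfold_locales
  have "locality_L1 M E \<and> locality_L2 M E \<and> locality_L3 M E" if "locality_L0 M E"
  proof -
    interpret local_Dirichlet M E
      using that by unfold_locales
    show ?thesis using locality_L1 locality_L2 locality_L3 by blast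
  qed
  then show ?thesis
    using locality_L0_if_L1 locality_L0_if_L2 locality_L0_if_L3 by blast
qed

end
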